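(* Let $s_1,s_2,s_3,s_4$ be the canonical generators of $\mathcal O_4$ and write $s_{ij,k}:=s_is_js_k^*$ for $i,j,k\in\{1,2,3,4\}$. Define unital $*$-endomorphisms $\rho,\bar\rho$ of $\mathcal O_4$ by $$\begin{aligned}\rho(s_1)&:=s_{23,1}+s_{14,2}+s_{21,3}+s_{12,4},&\bar\rho(s_1)&:=s_{32,1}+s_{31,2}+s_{14,3}+s_{13,4},\\ \rho(s_2)&:=s_{13,1}+s_{24,2}+s_{11,3}+s_{22,4},&\bar\rho(s_2)&:=s_{41,1}+s_{42,2}+s_{23,3}+s_{24,4},\\ \rho(s_3)&:=s_{41,1}+s_{32,2}+s_{43,3}+s_{34,4},&\bar\rho(s_3)&:=s_{12,1}+s_{11,2}+s_{34,3}+s_{33,4},\\ \rho(s_4)&:=s_{31,1}+s_{42,2}+s_{33,3}+s_{44,4},&\bar\rho(s_4)&:=s_{21,1}+s_{22,2}+s_{43,3}+s_{44,4}.\end{aligned}$$ Then the following holds. (i) $P_4(1)\circ\rho=P_4(24)$ and $P_4(1)\circ\bar\rho=P_4(34)$; that is, if a representation $\pi$ of $\mathcal O_4$ is $P_4(1)$, then $\pi\circ\rho$ is $P_4(24)$ and $\pi\circ\bar\rho$ is $P_4(34)$. (ii) Both $\rho$ and $\bar\rho$ are irreducible and are not automorphisms. (iii) $\rho$ and $\bar\rho$ are not equivalent.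
   Context: $\mathcal O_N$ ($N\ge2$) is the Cuntz algebra: the universal C$^*$-algebra generated by $s_1,\dots,s_N$ (the canonical generators) with $s_i^*s_j=\delta_{ij}I$ and $\sum_{i=1}^N s_is_i^*=I$. All representations and endomorphisms are unital and $*$-preserving. For $J=(j_1,\dots,j_k)\in\{1,\dots,N\}^k$ (written $j_1\cdots j_k$ for short, e.g. $P_4(24)=P_4((2,4))$), a representation $(\mathcal H,\pi)$ of $\mathcal O_N$ is $P_N(J)$ if there is a unit cyclic vector $\Omega\in\mathcal H$ such that $\pi(s_{j_1}\cdots s_{j_k})\Omega=\Omega$ and $\{\pi(s_{j_l}\cdots s_{j_k})\Omega\}_{l=1}^k$ is an orthonormal family in $\mathcal H$. An endomorphism $\rho$ of a unital C$^*$-algebra $\mathcal A$ is irreducible if $\rho(\mathcal A)'\cap\mathcal A=\mathbf CI$. Two endomorphisms $\rho,\rho'$ of $\mathcal A$ are equivalent if there is a unitary $u\in\mathcal A$ with $\mathrm{Ad}u\circ\rho=\rho'$, where $\mathrm{Ad}u(x)=uxu^*$. *)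

theory Defs
  imports "HOL-Analysis.Analysis" "HOL-Library.Poly_Mapping"
begin

section \<open>Unital C*-algebras and their morphisms\<close>

class scaleC =
  fixes scaleC :: "complex \<Rightarrow> 'a \<Rightarrow> 'a"  (infixr \<open>*\<^sub>C\<close> 75)

class star =
  fixes star :: "'a \<Rightarrow> 'a"  (\<open>_\<^sup>\<star>\<close> [1000] 999)

class cstar_algebra = real_normed_algebra_1 + banach + scaleC + star +
  assumes scaleR_scaleC: "r *\<^sub>R x = complex_of_real r *\<^sub>C x"
    and scaleC_add_right: "c *\<^sub>C (x + y) = c *\<^sub>C x + c *\<^sub>C y"
    and scaleC_add_left: "(c + d) *\<^sub>C x = c *\<^sub>C x + d *\<^sub>C x"
    and scaleC_scaleC: "c *\<^sub>C d *\<^sub>C x = (c * d) *\<^sub>C x"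
    and scaleC_one: "1 *\<^sub>C x = x"
    and mult_scaleC_left: "(c *\<^sub>C x) * y = c *\<^sub>C (x * y)"
    and mult_scaleC_right: "x * (c *\<^sub>C y) = c *\<^sub>C (x * y)"
    and norm_scaleC: "norm (c *\<^sub>C x) = cmod c * norm x"
    and star_star: "(x\<^sup>\<star>)\<^sup>\<star> = x"
    and star_add: "(x + y)\<^sup>\<star> = x\<^sup>\<star> + y\<^sup>\<star>"
    and star_scaleC: "(c *\<^sub>C x)\<^sup>\<star> = cnj c *\<^sub>C x\<^sup>\<star>"
    and star_mult: "(x * y)\<^sup>\<star> = y\<^sup>\<star> * x\<^sup>\<star>"
    and norm_star_mult_self: "norm (x\<^sup>\<star> * x) = (norm x)\<^sup>2"

definition unital_star_hom :: "('a::cstar_algebra \<Rightarrow> 'b::cstar_algebra) \<Rightarrow> bool" where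
  "unital_star_hom \<phi> \<longleftrightarrow>
     (\<forall>x y. \<phi> (x + y) = \<phi> x + \<phi> y) \<and> (\<forall>c x. \<phi> (c *\<^sub>C x) = c *\<^sub>C \<phi> x) \<and>
     (\<forall>x y. \<phi> (x * y) = \<phi> x * \<phi> y) \<and> \<phi> 1 = 1 \<and> (\<forall>x. \<phi> (x\<^sup>\<star>) = (\<phi> x)\<^sup>\<star>)"

abbreviation endomorphism :: "('a::cstar_algebra \<Rightarrow> 'a) \<Rightarrow> bool" where
  "endomorphism \<equiv> unital_star_hom"

definition automorphism :: "('a::cstar_algebra \<Rightarrow> 'a) \<Rightarrow> bool" where
  "automorphism \<phi> \<longleftrightarrow> endomorphism \<phi> \<and> bij \<phi>"

definition commutant :: "'a::cstar_algebra set \<Rightarrow> 'a set" where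
  "commutant S = {x. \<forall>y\<in>S. x * y = y * x}"

definition irreducible_endo :: "('a::cstar_algebra \<Rightarrow> 'a) \<Rightarrow> bool" where
  "irreducible_endo \<rho> \<longleftrightarrow> commutant (range \<rho>) = range (\<lambda>c. c *\<^sub>C 1)"

definition unitary :: "'a::cstar_algebra \<Rightarrow> bool" where
  "unitary u \<longleftrightarrow> u\<^sup>\<star> * u = 1 \<and> u * u\<^sup>\<star> = 1"

definition Ad :: "'a::cstar_algebra \<Rightarrow> 'a \<Rightarrow> 'a" where
  "Ad u x = u * x * u\<^sup>\<star>"

definition equivalent_endo :: "('a::cstar_algebra \<Rightarrow> 'a) \<Rightarrow> ('a \<Rightarrow> 'a) \<Rightarrow> bool" where
  "equivalent_endo \<rho> \<rho>' \<longleftrightarrow> (\<exists>u. unitary u \<and> Ad u \<circ> \<rho> = \<rho>')"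

section \<open>Hilbert spaces and representations\<close>

class chilbert_space = real_normed_vector + complete_space + scaleC +
  fixes cinner :: "'a \<Rightarrow> 'a \<Rightarrow> complex"
  assumes hscaleR_scaleC: "r *\<^sub>R x = complex_of_real r *\<^sub>C x"
    and hscaleC_add_right: "c *\<^sub>C (x + y) = c *\<^sub>C x + c *\<^sub>C y"
    and hscaleC_add_left: "(c + d) *\<^sub>C x = c *\<^sub>C x + d *\<^sub>C x"
    and hscaleC_scaleC: "c *\<^sub>C d *\<^sub>C x = (c * d) *\<^sub>C x"
    and hscaleC_one: "1 *\<^sub>C x = x"
    and cinner_commute: "cinner x y = cnj (cinner y x)"
    and cinner_add_right: "cinner x (y + z) = cinner x y + cinner x z"
    and cinner_scaleC_right: "cinner x (c *\<^sub>C y) = c * cinner x y"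
    and cinner_self: "complex_of_real ((norm x)\<^sup>2) = cinner x x"

definition bounded_operator :: "('h::chilbert_space \<Rightarrow> 'h) \<Rightarrow> bool" where
  "bounded_operator T \<longleftrightarrow> bounded_linear T \<and> (\<forall>c x. T (c *\<^sub>C x) = c *\<^sub>C T x)"

definition representation :: "('a::cstar_algebra \<Rightarrow> 'h::chilbert_space \<Rightarrow> 'h) \<Rightarrow> bool" where
  "representation \<pi> \<longleftrightarrow>
     (\<forall>a. bounded_operator (\<pi> a)) \<and>
     (\<forall>a b v. \<pi> (a + b) v = \<pi> a v + \<pi> b v) \<and> (\<forall>c a v. \<pi> (c *\<^sub>C a) v = c *\<^sub>C \<pi> a v) \<and>
     (\<forall>a b v. \<pi> (a * b) v = \<pi> a (\<pi> b v)) \<and> (\<forall>v. \<pi> 1 v = v) \<and>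
     (\<forall>a v w. cinner (\<pi> (a\<^sup>\<star>) v) w = cinner v (\<pi> a w))"

text \<open>The set of all \<open>\<pi> a \<Omega>\<close> is already a linear subspace, so no span is taken.\<close>

definition cyclic_vector :: "('a::cstar_algebra \<Rightarrow> 'h::chilbert_space \<Rightarrow> 'h) \<Rightarrow> 'h \<Rightarrow> bool" where
  "cyclic_vector \<pi> \<Omega> \<longleftrightarrow> closure (range (\<lambda>a. \<pi> a \<Omega>)) = UNIV"

section \<open>The free *-algebra on a finite set of generators\<close>

text \<open>The letter \<open>(i, False)\<close> stands for the generator \<open>s\<^sub>i\<close> and \<open>(i, True)\<close> for its adjoint.
  Words form the free monoid, written additively so that \<open>'n free_word \<Rightarrow>\<^sub>0 complex\<close> is its
  monoid algebra.\<close>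

datatype 'n free_word = Word (letters: "('n \<times> bool) list")

instantiation free_word :: (type) monoid_add
begin
definition zero_free_word where "zero_free_word = Word []"
definition plus_free_word where "plus_free_word u v = Word (letters u @ letters v)"
instance
  by standard (simp_all add: zero_free_word_def plus_free_word_def)
end

definition word_star :: "'n free_word \<Rightarrow> 'n free_word" where
  "word_star w = Word (rev (map (\<lambda>(i, b). (i, \<not> b)) (letters w)))"

lemma word_star_star [simp]: "word_star (word_star w) = w"
  by (cases w) (simp add: word_star_def rev_map [symmetric] comp_def case_prod_beta)

lemma word_star_add: "word_star (u + v) = word_star v + word_star u"
  by (simp add: word_star_def plus_free_word_def)

lemma word_star_zero [simp]: "word_star 0 = 0"
  by (simp add: word_star_def zero_free_word_def)

type_synonym 'n free_alg = "'n free_word \<Rightarrow>\<^sub>0 complex"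

lemma poly_mapping_add_induct [case_names zero add]:
  fixes p :: "'a \<Rightarrow>\<^sub>0 'b::ab_group_add"
  assumes "P 0" and "\<And>w c p. P p \<Longrightarrow> P (Poly_Mapping.single w c + p)"
  shows "P p"
proof (induction p rule: Poly_Mapping.update_induct)
  case const
  then show ?case by (rule assms)
next
  case (update f a b)
  have "Poly_Mapping.update a b f = Poly_Mapping.single a b + f"
    using update
    by (intro poly_mapping_eqI)
       (auto simp: Poly_Mapping.lookup_update lookup_add lookup_single in_keys_iff when_def)
  then show ?case using assms(2) update by simp
qed

definition lin_ext :: "('k \<Rightarrow> 'c::ab_group_add \<Rightarrow> 'b::ab_group_add) \<Rightarrow> ('k \<Rightarrow>\<^sub>0 'c) \<Rightarrow> 'b" where
  "lin_ext f p = (\<Sum>w\<in>Poly_Mapping.keys p. f w (Poly_Mapping.lookup p w))"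

lemma lin_ext_add:
  assumes "\<And>w c d. f w (c + d) = f w c + f w d"
  shows "lin_ext f (p + q) = lin_ext f p + lin_ext f q"
proof -
  have "f w 0 = 0" for w
    using assms[of w 0 0] by simp
  then show ?thesis
    unfolding lin_ext_def by (intro setsum_keys_plus_distrib) (auto simp: assms)
qed

lemma lin_ext_single:
  assumes "\<And>w. f w 0 = 0"
  shows "lin_ext f (Poly_Mapping.single w c) = f w c"
  by (simp add: lin_ext_def assms)

lemma lin_ext_zero [simp]: "lin_ext f 0 = 0"
  by (simp add: lin_ext_def)

definition fscale :: "complex \<Rightarrow> 'n free_alg \<Rightarrow> 'n free_alg" where
  "fscale c p = Poly_Mapping.single 0 c * p"

definition fstar :: "'n free_alg \<Rightarrow> 'n free_alg" where
  "fstar = lin_ext (\<lambda>w c. Poly_Mapping.single (word_star w) (cnj c))"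

definition fgen :: "'n \<Rightarrow> 'n free_alg" where
  "fgen i = Poly_Mapping.single (Word [(i, False)]) 1"

lemma fscale_single: "fscale c (Poly_Mapping.single w d) = Poly_Mapping.single w (c * d)"
  by (simp add: fscale_def mult_single)

lemma fscale_add_right: "fscale c (p + q) = fscale c p + fscale c q"
  by (simp add: fscale_def distrib_left)

lemma fscale_add_left: "fscale (c + d) p = fscale c p + fscale d p"
  by (simp add: fscale_def distrib_right single_add)

lemma fscale_fscale: "fscale c (fscale d p) = fscale (c * d) p"
  by (simp add: fscale_def mult.assoc [symmetric] mult_single)

lemma fscale_one [simp]: "fscale 1 p = p"
  by (simp add: fscale_def)

lemma fscale_zero [simp]: "fscale 0 p = 0"
  by (simp add: fscale_def)

lemma fscale_minus_one: "fscale (- 1) p = - p"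
  by (simp add: fscale_def single_uminus)

lemma mult_fscale_left: "fscale c p * q = fscale c (p * q)"
  by (simp add: fscale_def mult.assoc)

lemma mult_fscale_right: "p * fscale c q = fscale c (p * q)"
proof -
  have "p * Poly_Mapping.single 0 c = Poly_Mapping.single 0 c * p"
    by (induction p rule: poly_mapping_add_induct)
       (simp_all add: distrib_left distrib_right mult_single mult.commute)
  then show ?thesis
    by (simp add: fscale_def mult.assoc [symmetric])
qed

lemma fstar_add: "fstar (p + q) = fstar p + fstar q"
  unfolding fstar_def by (rule lin_ext_add) (simp add: single_add)

lemma fstar_single: "fstar (Poly_Mapping.single w c) = Poly_Mapping.single (word_star w) (cnj c)"
  unfolding fstar_def by (rule lin_ext_single) simp

lemma fstar_zero [simp]: "fstar 0 = 0"
  by (simp add: fstar_def)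

lemma fstar_one [simp]: "fstar 1 = 1"
  using fstar_single[of 0 1] by simp

lemma fstar_fstar [simp]: "fstar (fstar p) = p"
  by (induction p rule: poly_mapping_add_induct) (simp_all add: fstar_add fstar_single)

lemma fstar_single_mult:
  "fstar (Poly_Mapping.single w c * q) = fstar q * fstar (Poly_Mapping.single w c)"
  by (induction q rule: poly_mapping_add_induct)
     (simp_all add: distrib_left distrib_right fstar_add fstar_single mult_single word_star_add
        mult.commute)

lemma fstar_mult: "fstar (p * q) = fstar q * fstar p"
  by (induction p rule: poly_mapping_add_induct)
     (simp_all add: distrib_left distrib_right fstar_add fstar_single_mult)

lemma fstar_fscale: "fstar (fscale c p) = fscale (cnj c) (fstar p)"
  by (induction p rule: poly_mapping_add_induct)
     (simp_all add: fscale_add_right fstar_add fscale_single fstar_single, simp add: fscale_def)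

lemma fstar_minus: "fstar (p - q) = fstar p - fstar q"
  by (metis add_diff_cancel diff_add_cancel fstar_add)

lemma free_alg_induct [case_names one gen star add scale mult]:
  assumes "P 1" "\<And>i. P (fgen i)" "\<And>p. P p \<Longrightarrow> P (fstar p)"
    "\<And>p q. P p \<Longrightarrow> P q \<Longrightarrow> P (p + q)" "\<And>c p. P p \<Longrightarrow> P (fscale c p)"
    "\<And>p q. P p \<Longrightarrow> P q \<Longrightarrow> P (p * q)"
  shows "P (p :: 'n free_alg)"
proof -
  have w: "P (Poly_Mapping.single (Word xs) 1)" for xs
  proof (induction xs)
    case Nil
    then show ?case using assms(1) by (simp flip: zero_free_word_def)
  next
    case (Cons x xs)
    obtain i b where x: "x = (i, b)" by (cases x)
    have "P (Poly_Mapping.single (Word [x]) 1)"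
    proof (cases b)
      case False
      then show ?thesis using assms(2)[of i] by (simp add: x fgen_def)
    next
      case True
      have "fstar (fgen i) = Poly_Mapping.single (Word [x]) 1"
        using True by (simp add: fgen_def fstar_single word_star_def x)
      then show ?thesis using assms(3)[OF assms(2)[of i]] by simp
    qed
    moreover have "Poly_Mapping.single (Word [x]) 1 * Poly_Mapping.single (Word xs) 1
        = Poly_Mapping.single (Word (x # xs)) (1::complex)"
      by (simp add: mult_single plus_free_word_def)
    ultimately show ?case using assms(6)[OF _ Cons] by metis
  qed
  have s: "P (Poly_Mapping.single v c)" for v c
    using assms(5)[OF w, of c "letters v"] by (simp add: fscale_single)
  show ?thesis
  proof (induction p rule: poly_mapping_add_induct)
    case zero
    then show ?case using s[of 0 0] by simp
  next
    case (add w c p)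
    then show ?case using assms(4) s by blast
  qed
qed

section \<open>The universal C*-norm for the Cuntz relations\<close>

definition cstar_seminorm :: "('n free_alg \<Rightarrow> real) \<Rightarrow> bool" where
  "cstar_seminorm q \<longleftrightarrow>
     (\<forall>p r. q (p + r) \<le> q p + q r) \<and> (\<forall>c p. q (fscale c p) = cmod c * q p) \<and>
     (\<forall>p r. q (p * r) \<le> q p * q r) \<and> (\<forall>p. q (fstar p * p) = (q p)\<^sup>2)"

definition cuntz_seminorm :: "('n::finite free_alg \<Rightarrow> real) \<Rightarrow> bool" where
  "cuntz_seminorm q \<longleftrightarrow> cstar_seminorm q \<and>
     (\<forall>i j. q (fstar (fgen i) * fgen j - (if i = j then 1 else 0)) = 0) \<and>
     q ((\<Sum>i\<in>UNIV. fgen i * fstar (fgen i)) - 1) = 0"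

text \<open>These seminorms are exactly the pullbacks of C*-norms along *-homomorphisms sending the
  generators to a family satisfying the Cuntz relations, so their supremum is the norm of the
  universal C*-algebra.\<close>

definition cuntz_norm :: "'n::finite free_alg \<Rightarrow> real" where
  "cuntz_norm p = (SUP q\<in>Collect cuntz_seminorm. q p)"

lemma cstar_seminormD:
  assumes "cstar_seminorm q"
  shows "q (p + r) \<le> q p + q r" "q (fscale c p) = cmod c * q p"
    "q (p * r) \<le> q p * q r" "q (fstar p * p) = (q p)\<^sup>2"
  using assms unfolding cstar_seminorm_def by blast+

lemma cstar_seminorm_zero: "cstar_seminorm q \<Longrightarrow> q 0 = 0"
  using cstar_seminormD(2)[of q 0 0] by simp

lemma cstar_seminorm_minus: "cstar_seminorm q \<Longrightarrow> q (- p) = q p"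
  using cstar_seminormD(2)[of q "- 1" p] by (simp add: fscale_minus_one)

lemma cstar_seminorm_minus_commute: "cstar_seminorm q \<Longrightarrow> q (p - r) = q (r - p)"
  using cstar_seminorm_minus[of q "p - r"] by simp

lemma cstar_seminorm_nonneg: "cstar_seminorm q \<Longrightarrow> 0 \<le> q p"
  using cstar_seminormD(1)[of q p "- p"] cstar_seminorm_zero[of q] cstar_seminorm_minus[of q p]
  by simp

lemma cstar_seminorm_triangle_sub: "cstar_seminorm q \<Longrightarrow> q (p - r) \<le> q p + q r"
  using cstar_seminormD(1)[of q p "- r"] cstar_seminorm_minus[of q r] by simp

lemma cstar_seminorm_star:
  assumes "cstar_seminorm q"
  shows "q (fstar p) = q p"
proof -
  have le: "q p \<le> q (fstar p)" for p
  proof (cases "q p = 0")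
    case True
    then show ?thesis using cstar_seminorm_nonneg[OF assms] by simp
  next
    case False
    have "q p * q p \<le> q (fstar p) * q p"
      using cstar_seminormD(3,4)[OF assms] by (metis power2_eq_square)
    then show ?thesis
      using False cstar_seminorm_nonneg[OF assms, of p] by simp
  qed
  show ?thesis using le[of p] le[of "fstar p"] by simp
qed

lemma cstar_seminorm_one_le: 
  assumes "cstar_seminorm q"
  shows "q 1 \<le> 1"
proof -
  have "q 1 * (q 1 - 1) = 0"
    using cstar_seminormD(4)[OF assms, of 1] by (simp add: algebra_simps power2_eq_square)
  then show ?thesis by auto
qed

lemma cuntz_seminormD:
  assumes "cuntz_seminorm q"
  shows "cstar_seminorm q" "q (fstar (fgen i) * fgen j - (if i = j then 1 else 0)) = 0"
    "q ((\<Sum>i\<in>UNIV. fgen i * fstar (fgen i)) - 1) = 0"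
  using assms unfolding cuntz_seminorm_def by blast+

lemma cuntz_seminorm_fgen:
  assumes "cuntz_seminorm q"
  shows "q (fgen i) \<le> 1"
proof -
  note c = cuntz_seminormD(1)[OF assms]
  have "(q (fgen i))\<^sup>2 = q ((fstar (fgen i) * fgen i - 1) + 1)"
    using cstar_seminormD(4)[OF c] by simp
  also have "\<dots> \<le> q (fstar (fgen i) * fgen i - 1) + q 1"
    by (rule cstar_seminormD(1)[OF c])
  also have "\<dots> \<le> 1"
    using cuntz_seminormD(2)[OF assms, of i i] cstar_seminorm_one_le[OF c] by simp
  finally show ?thesis
    using power2_le_imp_le[of "q (fgen i)" 1] by simp
qed

lemma cuntz_seminorm_bdd: "\<exists>B. \<forall>q. cuntz_seminorm q \<longrightarrow> q p \<le> B"
proof (induction p rule: free_alg_induct)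
  case one
  then show ?case using cstar_seminorm_one_le cuntz_seminormD(1) by blast
next
  case (gen i)
  then show ?case using cuntz_seminorm_fgen by blast
next
  case (star p)
  then show ?case using cstar_seminorm_star cuntz_seminormD(1) by metis
next
  case (add p q)
  then obtain B C where BC: "\<forall>q. cuntz_seminorm q \<longrightarrow> q p \<le> B" "\<forall>r. cuntz_seminorm r \<longrightarrow> r q \<le> C"
    by blast
  have "r (p + q) \<le> B + C" if "cuntz_seminorm r" for r
    using that BC cstar_seminormD(1)[OF cuntz_seminormD(1)[OF that], of p q] by fastforce
  then show ?case by blast
next
  case (scale c p)
  then obtain B where B: "\<forall>q. cuntz_seminorm q \<longrightarrow> q p \<le> B"
    by blast
  have "r (fscale c p) \<le> cmod c * B" if "cuntz_seminorm r" for r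
    using that B cstar_seminormD(2)[OF cuntz_seminormD(1)[OF that], of c p]
    by (simp add: mult_left_mono)
  then show ?case by blast
next
  case (mult p q)
  then obtain B C where BC: "\<forall>q. cuntz_seminorm q \<longrightarrow> q p \<le> B" "\<forall>r. cuntz_seminorm r \<longrightarrow> r q \<le> C"
    by blast
  have "r (p * q) \<le> B * C" if "cuntz_seminorm r" for r
  proof -
    note c = cuntz_seminormD(1)[OF that]
    have "r (p * q) \<le> r p * r q" by (rule cstar_seminormD(3)[OF c])
    also have "\<dots> \<le> B * C"
      using BC that cstar_seminorm_nonneg[OF c] by (intro mult_mono) (auto intro: order_trans)
    finally show ?thesis .
  qed
  then show ?case by blast
qed

lemma cuntz_seminorm_zero: "cuntz_seminorm (\<lambda>_. 0)"
  by (simp add: cuntz_seminorm_def cstar_seminorm_def)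

lemma cuntz_norm_bdd_above: "bdd_above ((\<lambda>q. q p) ` Collect cuntz_seminorm)"
  using cuntz_seminorm_bdd[of p] by (auto simp: bdd_above_def)

lemma cuntz_norm_upper: "cuntz_seminorm q \<Longrightarrow> q p \<le> cuntz_norm p"
  unfolding cuntz_norm_def by (rule cSUP_upper[OF _ cuntz_norm_bdd_above]) simp

lemma cuntz_norm_least: "(\<And>q. cuntz_seminorm q \<Longrightarrow> q p \<le> B) \<Longrightarrow> cuntz_norm p \<le> B"
  unfolding cuntz_norm_def using cuntz_seminorm_zero by (intro cSUP_least) auto

lemma cuntz_norm_nonneg: "0 \<le> cuntz_norm p"
  using cuntz_norm_upper[OF cuntz_seminorm_zero] .

lemma cuntz_norm_scale_le: "cuntz_norm (fscale c p) \<le> cmod c * cuntz_norm p"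
proof (rule cuntz_norm_least)
  fix q :: "'a free_alg \<Rightarrow> real" assume q: "cuntz_seminorm q"
  show "q (fscale c p) \<le> cmod c * cuntz_norm p"
    using cstar_seminormD(2)[OF cuntz_seminormD(1)[OF q]] cuntz_norm_upper[OF q]
    by (simp add: mult_left_mono)
qed

lemma cuntz_norm_mult_le: "cuntz_norm (p * r) \<le> cuntz_norm p * cuntz_norm r"
proof (rule cuntz_norm_least)
  fix q :: "'a free_alg \<Rightarrow> real" assume q: "cuntz_seminorm q"
  show "q (p * r) \<le> cuntz_norm p * cuntz_norm r"
    using cstar_seminormD(3)[OF cuntz_seminormD(1)[OF q], of p r] cuntz_norm_upper[OF q]
      cstar_seminorm_nonneg[OF cuntz_seminormD(1)[OF q]]
    by (meson cuntz_norm_nonneg mult_mono order_trans)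
qed

theorem cuntz_seminorm_cuntz_norm: "cuntz_seminorm (cuntz_norm :: 'n::finite free_alg \<Rightarrow> real)"
proof -
  have star_le: "cuntz_norm (fstar p) \<le> cuntz_norm p" for p :: "'n free_alg"
    by (rule cuntz_norm_least) (simp add: cstar_seminorm_star cuntz_norm_upper cuntz_seminormD(1))
  have 1: "cuntz_norm (p + r) \<le> cuntz_norm p + cuntz_norm r" for p r :: "'n free_alg"
    by (rule cuntz_norm_least)
       (meson add_mono cstar_seminormD(1) cuntz_norm_upper cuntz_seminormD(1) order_trans)
  have 2: "cuntz_norm (fscale c p) = cmod c * cuntz_norm p" for c and p :: "'n free_alg"
  proof (cases "c = 0")
    case True
    then show ?thesis using cuntz_norm_scale_le[of 0 p] cuntz_norm_nonneg[of "0 :: 'n free_alg"]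
      by simp
  next
    case False
    have "cuntz_norm p \<le> cmod (inverse c) * cuntz_norm (fscale c p)"
      using cuntz_norm_scale_le[of "inverse c" "fscale c p"] False by (simp add: fscale_fscale)
    then have "cmod c * cuntz_norm p \<le> cuntz_norm (fscale c p)"
      using False by (simp add: norm_divide field_simps)
    then show ?thesis using cuntz_norm_scale_le[of c p] by simp
  qed
  have 4: "cuntz_norm (fstar p * p) = (cuntz_norm p)\<^sup>2" for p :: "'n free_alg"
  proof (rule antisym)
    show "cuntz_norm (fstar p * p) \<le> (cuntz_norm p)\<^sup>2"
      using cuntz_norm_mult_le[of "fstar p" p] star_le[of p] cuntz_norm_nonneg[of p]
      by (simp add: power2_eq_square) (meson mult_right_mono order_trans)
    have "cuntz_norm p \<le> sqrt (cuntz_norm (fstar p * p))"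
    proof (rule cuntz_norm_least)
      fix q :: "'n free_alg \<Rightarrow> real" assume q: "cuntz_seminorm q"
      show "q p \<le> sqrt (cuntz_norm (fstar p * p))"
        using cuntz_norm_upper[OF q, of "fstar p * p"] cstar_seminormD(4)[OF cuntz_seminormD(1)[OF q], of p]
        by (simp add: real_le_rsqrt)
    qed
    then have "(cuntz_norm p)\<^sup>2 \<le> (sqrt (cuntz_norm (fstar p * p)))\<^sup>2"
      by (intro power_mono cuntz_norm_nonneg)
    then show "(cuntz_norm p)\<^sup>2 \<le> cuntz_norm (fstar p * p)"
      by (simp only: real_sqrt_pow2 cuntz_norm_nonneg)
  qed
  have 5: "cuntz_norm p = 0" if "\<And>q. cuntz_seminorm q \<Longrightarrow> q p = 0" for p :: "'n free_alg"
    by (intro antisym cuntz_norm_least cuntz_norm_nonneg) (simp add: that)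
  show ?thesis
    unfolding cuntz_seminorm_def cstar_seminorm_def
    using 1 2 cuntz_norm_mult_le 4 5 cuntz_seminormD by blast
qed

section \<open>Nontriviality of the universal norm\<close>

text \<open>The isometries \<open>e\<^sub>w \<mapsto> e\<^sub>i\<^sub>w\<close> on the pre-Hilbert space with orthonormal basis indexed by
  infinite words give a Cuntz seminorm taking the value 1 at 1.\<close>

type_synonym 'n seq_space = "(nat \<Rightarrow> 'n) \<Rightarrow>\<^sub>0 complex"

lemma inj_case_nat: "inj (case_nat i :: (nat \<Rightarrow> 'n) \<Rightarrow> nat \<Rightarrow> 'n)"
proof (rule injI)
  fix u v :: "nat \<Rightarrow> 'n" assume "case_nat i u = case_nat i v"
  then have "case_nat i u (Suc n) = case_nat i v (Suc n)" for n by simp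
  then show "u = v" by (auto simp: fun_eq_iff)
qed

lemma case_nat_eta: "case_nat (w 0) (w \<circ> Suc) = w"
  by (auto simp: fun_eq_iff split: nat.split)

lemma case_nat_Suc: "case_nat i w \<circ> Suc = w"
  by (auto simp: fun_eq_iff)

lift_definition shift_op :: "'n \<Rightarrow> 'n seq_space \<Rightarrow> 'n seq_space" is
  "\<lambda>i x w. if w 0 = i then x (w \<circ> Suc) else 0"
proof -
  fix i :: 'n and x :: "(nat \<Rightarrow> 'n) \<Rightarrow> complex"
  assume "finite {w. x w \<noteq> 0}"
  then have "finite (case_nat i ` {w. x w \<noteq> 0})" by simp
  moreover have "{w. (if w 0 = i then x (w \<circ> Suc) else 0) \<noteq> 0} \<subseteq> case_nat i ` {w. x w \<noteq> 0}"
    by (auto split: if_splits simp: image_iff) (metis case_nat_eta)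
  ultimately show "finite {w. (if w 0 = i then x (w \<circ> Suc) else 0) \<noteq> 0}"
    by (rule rev_finite_subset)
qed

lift_definition unshift_op :: "'n \<Rightarrow> 'n seq_space \<Rightarrow> 'n seq_space" is
  "\<lambda>i x w. x (case_nat i w)"
proof -
  fix i :: 'n and x :: "(nat \<Rightarrow> 'n) \<Rightarrow> complex"
  assume "finite {w. x w \<noteq> 0}"
  then have "finite (case_nat i -` {w. x w \<noteq> 0})"
    by (rule finite_vimageI) (rule inj_case_nat)
  then show "finite {w. x (case_nat i w) \<noteq> 0}" by (simp add: vimage_def)
qed

lift_definition vscale :: "complex \<Rightarrow> 'n seq_space \<Rightarrow> 'n seq_space" is "\<lambda>c x w. c * x w"
  by (rule rev_finite_subset) auto

definition vinner :: "'n seq_space \<Rightarrow> 'n seq_space \<Rightarrow> complex" where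
  "vinner x y = (\<Sum>w\<in>Poly_Mapping.keys x. Poly_Mapping.lookup x w * cnj (Poly_Mapping.lookup y w))"

definition vnorm :: "'n seq_space \<Rightarrow> real" where
  "vnorm x = L2_set (\<lambda>w. cmod (Poly_Mapping.lookup x w)) (Poly_Mapping.keys x)"

lemma vinner_superset:
  assumes "finite A" "Poly_Mapping.keys x \<subseteq> A"
  shows "vinner x y = (\<Sum>w\<in>A. Poly_Mapping.lookup x w * cnj (Poly_Mapping.lookup y w))"
  unfolding vinner_def using assms by (intro sum.mono_neutral_left) (auto simp: in_keys_iff)

lemma vnorm_superset:
  assumes "finite A" "Poly_Mapping.keys x \<subseteq> A"
  shows "vnorm x = L2_set (\<lambda>w. cmod (Poly_Mapping.lookup x w)) A"
  unfolding vnorm_def L2_set_def using assms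
  by (intro arg_cong[where f = sqrt] sum.mono_neutral_left) (auto simp: in_keys_iff)

lemma vinner_commute: "vinner y x = cnj (vinner x y)"
proof -
  let ?A = "Poly_Mapping.keys x \<union> Poly_Mapping.keys y"
  show ?thesis
    by (simp add: vinner_superset[of ?A] mult.commute)
qed

lemma vinner_self: "vinner x x = complex_of_real ((vnorm x)\<^sup>2)"
  by (simp add: vinner_def vnorm_def L2_set_def sum_nonneg complex_norm_square del: of_real_power)

lemma vinner_add_right: "vinner x (y + z) = vinner x y + vinner x z"
  by (simp add: vinner_def lookup_add distrib_left sum.distrib)

lemma vinner_add_left: "vinner (x + y) z = vinner x z + vinner y z"
  by (metis vinner_add_right vinner_commute complex_cnj_add)

lemma vinner_vscale_right: "vinner x (vscale c y) = cnj c * vinner x y"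
  by (simp add: vinner_def vscale.rep_eq sum_distrib_left mult_ac)

lemma vinner_vscale_left: "vinner (vscale c x) y = c * vinner x y"
  by (metis vinner_vscale_right vinner_commute complex_cnj_cnj complex_cnj_mult)

lemma vinner_Cauchy_Schwarz: "cmod (vinner x y) \<le> vnorm x * vnorm y"
proof -
  let ?A = "Poly_Mapping.keys x \<union> Poly_Mapping.keys y"
  have "cmod (vinner x y) \<le> (\<Sum>w\<in>?A. \<bar>cmod (Poly_Mapping.lookup x w)\<bar> * \<bar>cmod (Poly_Mapping.lookup y w)\<bar>)"
    unfolding vinner_superset[of ?A x y, simplified] by (rule sum_norm_le) (simp add: norm_mult)
  also have "\<dots> \<le> vnorm x * vnorm y"
    using L2_set_mult_ineq[of "\<lambda>w. cmod (Poly_Mapping.lookup x w)" "\<lambda>w. cmod (Poly_Mapping.lookup y w)" ?A]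
    by (simp add: vnorm_superset[of ?A])
  finally show ?thesis .
qed

lemma vnorm_nonneg [simp]: "0 \<le> vnorm x"
  by (simp add: vnorm_def)

lemma vnorm_zero [simp]: "vnorm 0 = 0"
  by (simp add: vnorm_def)

lemma vnorm_triangle: "vnorm (x + y) \<le> vnorm x + vnorm y"
proof -
  let ?A = "Poly_Mapping.keys x \<union> Poly_Mapping.keys y"
  have "vnorm (x + y) \<le> L2_set (\<lambda>w. cmod (Poly_Mapping.lookup x w) + cmod (Poly_Mapping.lookup y w)) ?A"
    using Poly_Mapping.keys_add[of x y]
    by (simp add: vnorm_superset[of ?A] lookup_add norm_triangle_ineq L2_set_mono)
  also have "\<dots> \<le> vnorm x + vnorm y"
    by (rule order_trans[OF L2_set_triangle_ineq]) (simp add: vnorm_superset[of ?A])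
  finally show ?thesis .
qed

lemma vnorm_vscale: "vnorm (vscale c x) = cmod c * vnorm x"
proof -
  have "(vnorm (vscale c x))\<^sup>2 = (cmod c * vnorm x)\<^sup>2"
  proof -
    have "vinner (vscale c x) (vscale c x) = c * cnj c * vinner x x"
      by (simp add: vinner_vscale_left vinner_vscale_right)
    then have "complex_of_real ((vnorm (vscale c x))\<^sup>2) = complex_of_real ((cmod c * vnorm x)\<^sup>2)"
      by (simp add: vinner_self power_mult_distrib complex_norm_square flip: of_real_power)
    then show ?thesis by (simp only: of_real_eq_iff)
  qed
  then show ?thesis by (simp add: power2_eq_iff_nonneg)
qed

lemma vnorm_eq_0: "vnorm x = 0 \<Longrightarrow> x = 0"
  by (auto simp: vnorm_def L2_set_eq_0_iff in_keys_iff intro!: poly_mapping_eqI)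

lemma vscale_add: "vscale c (x + y) = vscale c x + vscale c y"
  by (rule poly_mapping_eqI) (simp add: vscale.rep_eq lookup_add distrib_left)

lemma vscale_add_left: "vscale (c + d) x = vscale c x + vscale d x"
  by (rule poly_mapping_eqI) (simp add: vscale.rep_eq lookup_add distrib_right)

lemma vscale_vscale: "vscale c (vscale d x) = vscale (c * d) x"
  by (rule poly_mapping_eqI) (simp add: vscale.rep_eq)

lemma vscale_one [simp]: "vscale 1 x = x"
  by (rule poly_mapping_eqI) (simp add: vscale.rep_eq)

lemma vscale_zero [simp]: "vscale 0 x = 0" "vscale c 0 = 0"
  by (rule poly_mapping_eqI, simp add: vscale.rep_eq)+

lemma shift_op_adjoint: "vinner (shift_op i x) y = vinner x (unshift_op i y)"
proof -
  have k: "Poly_Mapping.keys (shift_op i x) \<subseteq> case_nat i ` Poly_Mapping.keys x"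
    by (auto simp: in_keys_iff shift_op.rep_eq image_iff split: if_splits)
       (metis case_nat_eta in_keys_iff)
  have "vinner (shift_op i x) y = (\<Sum>w\<in>case_nat i ` Poly_Mapping.keys x.
      Poly_Mapping.lookup (shift_op i x) w * cnj (Poly_Mapping.lookup y w))"
    by (rule vinner_superset[OF _ k]) simp
  also have "\<dots> = vinner x (unshift_op i y)"
    by (subst sum.reindex)
       (auto simp: vinner_def shift_op.rep_eq unshift_op.rep_eq case_nat_Suc intro: inj_on_subset[OF inj_case_nat])
  finally show ?thesis .
qed

lemma unshift_op_adjoint: "vinner (unshift_op i x) y = vinner x (shift_op i y)"
  by (metis shift_op_adjoint vinner_commute)

lemma unshift_shift: "unshift_op i (shift_op j x) = (if i = j then x else 0)"
  by (rule poly_mapping_eqI) (simp add: unshift_op.rep_eq shift_op.rep_eq case_nat_Suc)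

lemma sum_shift_unshift: "(\<Sum>i\<in>UNIV. shift_op i (unshift_op i x)) = (x :: 'n::finite seq_space)"
proof (rule poly_mapping_eqI)
  fix w :: "nat \<Rightarrow> 'n"
  have "Poly_Mapping.lookup (\<Sum>i\<in>UNIV. shift_op i (unshift_op i x)) w =
      (\<Sum>i\<in>UNIV. if w 0 = i then Poly_Mapping.lookup x (case_nat i (w \<circ> Suc)) else 0)"
    by (simp add: lookup_sum shift_op.rep_eq unshift_op.rep_eq)
  also have "\<dots> = Poly_Mapping.lookup x w"
    by (simp add: case_nat_eta)
  finally show "Poly_Mapping.lookup (\<Sum>i\<in>UNIV. shift_op i (unshift_op i x)) w = Poly_Mapping.lookup x w" .
qed

lemma shift_op_add: "shift_op i (x + y) = shift_op i x + shift_op i y"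
  by (rule poly_mapping_eqI) (simp add: shift_op.rep_eq lookup_add)

lemma unshift_op_add: "unshift_op i (x + y) = unshift_op i x + unshift_op i y"
  by (rule poly_mapping_eqI) (simp add: unshift_op.rep_eq lookup_add)

lemma shift_op_vscale: "shift_op i (vscale c x) = vscale c (shift_op i x)"
  by (rule poly_mapping_eqI) (simp add: shift_op.rep_eq vscale.rep_eq)

lemma unshift_op_vscale: "unshift_op i (vscale c x) = vscale c (unshift_op i x)"
  by (rule poly_mapping_eqI) (simp add: unshift_op.rep_eq vscale.rep_eq)

lemma vnorm_shift_op: "vnorm (shift_op i x) = vnorm x"
proof -
  have "complex_of_real ((vnorm (shift_op i x))\<^sup>2) = complex_of_real ((vnorm x)\<^sup>2)"
    by (simp only: vinner_self[symmetric] shift_op_adjoint unshift_shift) simp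
  then have "(vnorm (shift_op i x))\<^sup>2 = (vnorm x)\<^sup>2"
    by (simp only: of_real_eq_iff)
  then show ?thesis by (simp add: power2_eq_iff_nonneg)
qed

lemma vnorm_unshift_op: "vnorm (unshift_op i x) \<le> vnorm x"
proof -
  have "(vnorm (unshift_op i x))\<^sup>2 = cmod (vinner (unshift_op i x) (unshift_op i x))"
    by (simp only: vinner_self norm_of_real) simp
  also have "\<dots> = cmod (vinner x (shift_op i (unshift_op i x)))"
    by (simp only: unshift_op_adjoint)
  also have "\<dots> \<le> vnorm x * vnorm (unshift_op i x)"
    using vinner_Cauchy_Schwarz vnorm_shift_op by metis
  finally have "vnorm (unshift_op i x) * vnorm (unshift_op i x) \<le> vnorm x * vnorm (unshift_op i x)"
    by (simp add: power2_eq_square)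
  then show ?thesis
    by (cases "vnorm (unshift_op i x) = 0") (auto simp: less_le)
qed

definition letter_op :: "'n \<times> bool \<Rightarrow> 'n seq_space \<Rightarrow> 'n seq_space" where
  "letter_op l = (if snd l then unshift_op (fst l) else shift_op (fst l))"

definition word_op :: "'n free_word \<Rightarrow> 'n seq_space \<Rightarrow> 'n seq_space" where
  "word_op w x = foldr letter_op (letters w) x"

definition free_op :: "'n free_alg \<Rightarrow> 'n seq_space \<Rightarrow> 'n seq_space" where
  "free_op p x = lin_ext (\<lambda>w c. vscale c (word_op w x)) p"

lemma word_op_add: "word_op w (x + y) = word_op w x + word_op w y"
proof -
  have "foldr letter_op l (x + y) = foldr letter_op l x + foldr letter_op l y" for l
    by (induction l) (auto simp: letter_op_def shift_op_add unshift_op_add)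
  then show ?thesis by (simp add: word_op_def)
qed

lemma word_op_vscale: "word_op w (vscale c x) = vscale c (word_op w x)"
proof -
  have "foldr letter_op l (vscale c x) = vscale c (foldr letter_op l x)" for l
    by (induction l) (auto simp: letter_op_def shift_op_vscale unshift_op_vscale)
  then show ?thesis by (simp add: word_op_def)
qed

lemma word_op_plus: "word_op (v + w) x = word_op v (word_op w x)"
  by (simp add: word_op_def plus_free_word_def)

lemma vnorm_word_op: "vnorm (word_op w x) \<le> vnorm x"
proof -
  have "vnorm (foldr letter_op l x) \<le> vnorm x" for l
  proof (induction l)
    case (Cons a l)
    have "vnorm (letter_op a y) \<le> vnorm y" for y
      by (simp add: letter_op_def vnorm_shift_op vnorm_unshift_op)
    then show ?case using Cons order_trans by fastforce
  qed simp
  then show ?thesis by (simp add: word_op_def)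
qed

lemma word_op_adjoint: "vinner (word_op w x) y = vinner x (word_op (word_star w) y)"
proof -
  have "vinner (foldr letter_op l x) y =
      vinner x (foldr letter_op (rev (map (\<lambda>(i, b). (i, \<not> b)) l)) y)" for l
  proof (induction l arbitrary: y)
    case (Cons a l)
    have "vinner (letter_op a u) y = vinner u (letter_op (fst a, \<not> snd a) y)" for u
      by (simp add: letter_op_def shift_op_adjoint unshift_op_adjoint)
    then show ?case using Cons by (simp add: case_prod_beta)
  qed simp
  then show ?thesis by (simp add: word_op_def word_star_def)
qed

lemma free_op_add: "free_op (p + q) x = free_op p x + free_op q x"
  unfolding free_op_def by (rule lin_ext_add) (rule vscale_add_left)

lemma free_op_single: "free_op (Poly_Mapping.single w c) x = vscale c (word_op w x)"
  unfolding free_op_def by (rule lin_ext_single) simp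

lemma free_op_zero [simp]: "free_op 0 x = 0"
  by (simp add: free_op_def)

lemma free_op_minus: "free_op (p - q) x = free_op p x - free_op q x"
  by (metis add_diff_cancel diff_add_cancel free_op_add)

lemma free_op_sum: "free_op (sum f A) x = (\<Sum>a\<in>A. free_op (f a) x)"
  by (induction A rule: infinite_finite_induct) (auto simp: free_op_add)

lemma free_op_add_right: "free_op p (x + y) = free_op p x + free_op p y"
  by (induction p rule: poly_mapping_add_induct)
     (simp_all add: free_op_add free_op_single word_op_add vscale_add)

lemma free_op_vscale: "free_op p (vscale c x) = vscale c (free_op p x)"
  by (induction p rule: poly_mapping_add_induct)
     (simp_all add: free_op_add free_op_single word_op_vscale vscale_add vscale_vscale mult.commute)

lemma free_op_fscale: "free_op (fscale c p) x = vscale c (free_op p x)"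
  by (induction p rule: poly_mapping_add_induct)
     (simp_all add: free_op_add fscale_add_right fscale_single free_op_single vscale_add
        vscale_vscale, simp add: fscale_def)

lemma free_op_one [simp]: "free_op 1 x = x"
proof -
  have "word_op 0 x = x" by (simp add: word_op_def zero_free_word_def)
  then show ?thesis using free_op_single[of 0 1 x] by simp
qed

lemma free_op_zero_right [simp]: "free_op p 0 = 0"
  using free_op_vscale[of p 0 0] by simp

lemma free_op_single_mult:
  "free_op (Poly_Mapping.single w c * q) x = free_op (Poly_Mapping.single w c) (free_op q x)"
  by (induction q rule: poly_mapping_add_induct)
     (simp_all add: distrib_left free_op_add free_op_add_right mult_single free_op_single word_op_plus
        vscale_add word_op_add word_op_vscale vscale_vscale)

lemma free_op_mult: "free_op (p * q) x = free_op p (free_op q x)"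
  by (induction p rule: poly_mapping_add_induct)
     (simp_all add: distrib_right free_op_add free_op_single_mult)

lemma free_op_adjoint: "vinner (free_op p x) y = vinner x (free_op (fstar p) y)"
proof (induction p rule: poly_mapping_add_induct)
  case zero
  then show ?case by (simp add: vinner_def)
next
  case (add w c p)
  then show ?case
    by (simp add: free_op_add free_op_single fstar_add fstar_single vinner_add_left vinner_add_right
        vinner_vscale_left vinner_vscale_right word_op_adjoint)
qed

lemma free_op_fgen: "free_op (fgen i) x = shift_op i x"
  by (simp add: fgen_def free_op_single word_op_def letter_op_def)

lemma free_op_fstar_fgen: "free_op (fstar (fgen i)) x = unshift_op i x"
  by (simp add: fgen_def fstar_single word_star_def free_op_single word_op_def letter_op_def)

lemma free_op_bounded: "\<exists>B. \<forall>x. vnorm (free_op p x) \<le> B * vnorm x"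
proof (induction p rule: poly_mapping_add_induct)
  case zero
  have "\<forall>x::'a seq_space. vnorm (free_op 0 x) \<le> 0 * vnorm x" by simp
  then show ?case by blast
next
  case (add w c p)
  then obtain B where B: "\<And>x. vnorm (free_op p x) \<le> B * vnorm x" by blast
  have "vnorm (free_op (Poly_Mapping.single w c + p) x) \<le> (cmod c + B) * vnorm x" for x
  proof -
    have "vnorm (free_op (Poly_Mapping.single w c + p) x)
        \<le> cmod c * vnorm (word_op w x) + vnorm (free_op p x)"
      using vnorm_triangle by (metis free_op_add free_op_single vnorm_vscale)
    also have "\<dots> \<le> cmod c * vnorm x + B * vnorm x"
      by (intro add_mono mult_left_mono vnorm_word_op B) simp
    finally show ?thesis by (simp add: distrib_right)
  qed
  then show ?case by blast
qed

definition op_norm :: "'n free_alg \<Rightarrow> real" where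
  "op_norm p = (SUP x\<in>{x. vnorm x \<le> 1}. vnorm (free_op p x))"

lemma op_norm_bdd: "bdd_above ((\<lambda>x. vnorm (free_op p x)) ` {x. vnorm x \<le> 1})"
proof -
  obtain B where B: "\<And>x. vnorm (free_op p x) \<le> B * vnorm x" using free_op_bounded by blast
  have "vnorm (free_op p x) \<le> \<bar>B\<bar>" if "vnorm x \<le> 1" for x
  proof -
    have "B * vnorm x \<le> \<bar>B\<bar> * 1"
      using that by (intro mult_mono) auto
    then show ?thesis using B[of x] by linarith
  qed
  then show ?thesis by (auto simp: bdd_above_def)
qed

lemma op_norm_least: "(\<And>x. vnorm x \<le> 1 \<Longrightarrow> vnorm (free_op p x) \<le> B) \<Longrightarrow> op_norm p \<le> B"
  unfolding op_norm_def by (intro cSUP_least) (auto intro: exI[of _ 0])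

lemma op_norm_upper1: "vnorm x \<le> 1 \<Longrightarrow> vnorm (free_op p x) \<le> op_norm p"
  unfolding op_norm_def by (intro cSUP_upper op_norm_bdd) simp

lemma op_norm_nonneg: "0 \<le> op_norm p"
  using op_norm_upper1[of 0 p] by simp

lemma op_norm_upper: "vnorm (free_op p x) \<le> op_norm p * vnorm x"
proof (cases "vnorm x = 0")
  case True
  then show ?thesis using vnorm_eq_0[of x] by simp
next
  case False
  define y where "y = vscale (complex_of_real (inverse (vnorm x))) x"
  have "vnorm y = 1" using False by (simp add: y_def vnorm_vscale norm_inverse)
  then have "vnorm (free_op p y) \<le> op_norm p" by (simp add: op_norm_upper1)
  then show ?thesis
    using False by (simp add: y_def free_op_vscale vnorm_vscale norm_inverse norm_divide field_simps less_le)
qed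

lemma op_norm_mult: "op_norm (p * q) \<le> op_norm p * op_norm q"
proof (rule op_norm_least)
  fix x :: "'a seq_space" assume x: "vnorm x \<le> 1"
  have "vnorm (free_op (p * q) x) \<le> op_norm p * vnorm (free_op q x)"
    by (simp add: free_op_mult op_norm_upper)
  also have "\<dots> \<le> op_norm p * op_norm q"
    by (simp add: mult_left_mono op_norm_nonneg op_norm_upper1 x)
  finally show "vnorm (free_op (p * q) x) \<le> op_norm p * op_norm q" .
qed

lemma op_norm_cstar_le: "(op_norm p)\<^sup>2 \<le> op_norm (fstar p * p)"
proof -
  have "op_norm p \<le> sqrt (op_norm (fstar p * p))"
  proof (rule op_norm_least)
    fix x :: "'a seq_space" assume x: "vnorm x \<le> 1"
    have "(vnorm (free_op p x))\<^sup>2 = cmod (vinner (free_op p x) (free_op p x))"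
      by (simp only: vinner_self norm_of_real) simp
    also have "\<dots> = cmod (vinner x (free_op (fstar p * p) x))"
      by (simp only: free_op_adjoint free_op_mult)
    also have "\<dots> \<le> vnorm x * vnorm (free_op (fstar p * p) x)"
      by (rule vinner_Cauchy_Schwarz)
    also have "\<dots> \<le> 1 * op_norm (fstar p * p)"
      using x by (intro mult_mono op_norm_upper1) auto
    finally show "vnorm (free_op p x) \<le> sqrt (op_norm (fstar p * p))"
      by (simp add: real_le_rsqrt)
  qed
  then have "(op_norm p)\<^sup>2 \<le> (sqrt (op_norm (fstar p * p)))\<^sup>2"
    by (intro power_mono op_norm_nonneg)
  then show ?thesis by (simp only: real_sqrt_pow2 op_norm_nonneg)
qed

lemma op_norm_fstar_le: "op_norm (fstar p) \<le> op_norm p"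
proof (cases "op_norm (fstar p) = 0")
  case True
  then show ?thesis by (simp add: op_norm_nonneg)
next
  case False
  have "op_norm (fstar p) * op_norm (fstar p) \<le> op_norm p * op_norm (fstar p)"
    using op_norm_cstar_le[of "fstar p"] op_norm_mult[of p "fstar p"]
    by (simp add: power2_eq_square)
  then show ?thesis using False op_norm_nonneg[of "fstar p"] by (simp add: less_le)
qed

lemma op_norm_eq_zero: "(\<And>x. free_op p x = 0) \<Longrightarrow> op_norm p = 0"
  using op_norm_least[of p 0] op_norm_nonneg[of p] by (simp add: antisym)

lemma op_norm_fscale_le: "op_norm (fscale c p) \<le> cmod c * op_norm p"
  by (rule op_norm_least) (simp add: free_op_fscale vnorm_vscale mult_left_mono op_norm_upper1)

lemma op_norm_fscale: "op_norm (fscale c p) = cmod c * op_norm p"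
proof (cases "c = 0")
  case True
  then show ?thesis by (simp add: op_norm_eq_zero)
next
  case False
  have "op_norm p \<le> cmod (inverse c) * op_norm (fscale c p)"
    using op_norm_fscale_le[of "inverse c" "fscale c p"] False by (simp add: fscale_fscale)
  then have "cmod c * op_norm p \<le> op_norm (fscale c p)"
    using False by (simp add: norm_divide field_simps)
  then show ?thesis using op_norm_fscale_le[of c p] by simp
qed

lemma cuntz_seminorm_op_norm: "cuntz_seminorm (op_norm :: 'n::finite free_alg \<Rightarrow> real)"
proof -
  have 1: "op_norm (p + q) \<le> op_norm p + op_norm q" for p q :: "'n free_alg"
    by (rule op_norm_least)
       (metis add_mono free_op_add op_norm_upper1 order_trans vnorm_triangle)
  have 4: "op_norm (fstar p * p) = (op_norm p)\<^sup>2" for p :: "'n free_alg"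
  proof (rule antisym)
    show "op_norm (fstar p * p) \<le> (op_norm p)\<^sup>2"
      using op_norm_mult[of "fstar p" p] op_norm_fstar_le[of p] op_norm_nonneg[of p]
      by (simp add: power2_eq_square) (meson mult_right_mono order_trans)
  qed (rule op_norm_cstar_le)
  have 5: "op_norm (fstar (fgen i) * fgen j - (if i = j then 1 else 0)) = 0" for i j :: 'n
    by (rule op_norm_eq_zero)
       (simp add: free_op_minus free_op_mult free_op_fgen free_op_fstar_fgen unshift_shift)
  have 6: "op_norm ((\<Sum>i\<in>UNIV. fgen i * fstar (fgen i)) - 1 :: 'n free_alg) = 0"
    by (rule op_norm_eq_zero)
       (simp add: free_op_minus free_op_mult free_op_fgen free_op_fstar_fgen free_op_sum
          sum_shift_unshift)
  show ?thesis
    unfolding cuntz_seminorm_def cstar_seminorm_def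
    using 1 op_norm_fscale op_norm_mult 4 5 6 by blast
qed

lemma cuntz_norm_one: "cuntz_norm (1 :: 'n::finite free_alg) = 1"
proof (rule antisym)
  show "cuntz_norm (1 :: 'n free_alg) \<le> 1"
    by (rule cstar_seminorm_one_le[OF cuntz_seminormD(1)[OF cuntz_seminorm_cuntz_norm]])
  define e :: "'n seq_space" where "e = Poly_Mapping.single (\<lambda>_. undefined) 1"
  have "vnorm e = 1" by (simp add: e_def vnorm_def)
  then have "1 \<le> op_norm (1 :: 'n free_alg)"
    using op_norm_upper1[of e 1] by simp
  then show "1 \<le> cuntz_norm (1 :: 'n free_alg)"
    using cuntz_norm_upper[OF cuntz_seminorm_op_norm, of "1 :: 'n free_alg"] by linarith
qed

section \<open>The Cuntz algebra as the completion in the universal norm\<close>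

lemmas cuntz_norm_cstar = cuntz_seminormD(1)[OF cuntz_seminorm_cuntz_norm]
lemmas cuntz_norm_triangle = cstar_seminormD(1)[OF cuntz_norm_cstar]
lemmas cuntz_norm_fscale = cstar_seminormD(2)[OF cuntz_norm_cstar]
lemmas cuntz_norm_mult = cstar_seminormD(3)[OF cuntz_norm_cstar]
lemmas cuntz_norm_fstar_mult = cstar_seminormD(4)[OF cuntz_norm_cstar]
lemmas cuntz_norm_fstar = cstar_seminorm_star[OF cuntz_norm_cstar]
lemmas cuntz_norm_zero = cstar_seminorm_zero[OF cuntz_norm_cstar]
lemmas cuntz_norm_minus = cstar_seminorm_minus[OF cuntz_norm_cstar]
lemmas cuntz_norm_minus_commute = cstar_seminorm_minus_commute[OF cuntz_norm_cstar]
lemmas cuntz_norm_triangle_sub = cstar_seminorm_triangle_sub[OF cuntz_norm_cstar]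

lemma cuntz_norm_triangle3: "cuntz_norm (p - r) \<le> cuntz_norm (p - q) + cuntz_norm (q - r)"
  using cuntz_norm_triangle[of "p - q" "q - r"] by simp

lemma cuntz_norm_abs_diff: "\<bar>cuntz_norm p - cuntz_norm r\<bar> \<le> cuntz_norm (p - r)"
  using cuntz_norm_triangle[of "p - r" r] cuntz_norm_triangle[of "r - p" p]
    cuntz_norm_minus_commute[of p r] by (simp add: abs_le_iff)

lemma cuntz_norm_add_diff: "cuntz_norm ((p + q) - (p' + q')) \<le> cuntz_norm (p - p') + cuntz_norm (q - q')"
  using cuntz_norm_triangle[of "p - p'" "q - q'"] by (simp add: algebra_simps)

lemma cuntz_norm_mult_diff:
  "cuntz_norm (p * q - p' * q') \<le> cuntz_norm p * cuntz_norm (q - q') + cuntz_norm (p - p') * cuntz_norm q'"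
proof -
  have "p * q - p' * q' = p * (q - q') + (p - p') * q'"
    by (simp add: algebra_simps)
  then show ?thesis
    using cuntz_norm_triangle[of "p * (q - q')" "(p - p') * q'"] cuntz_norm_mult[of p "q - q'"]
      cuntz_norm_mult[of "p - p'" q'] by simp
qed

definition fcauchy :: "(nat \<Rightarrow> 'n::finite free_alg) \<Rightarrow> bool" where
  "fcauchy X \<longleftrightarrow> (\<forall>e>0. \<exists>M. \<forall>m\<ge>M. \<forall>n\<ge>M. cuntz_norm (X m - X n) < e)"

definition frel :: "(nat \<Rightarrow> 'n::finite free_alg) \<Rightarrow> (nat \<Rightarrow> 'n free_alg) \<Rightarrow> bool" where
  "frel X Y \<longleftrightarrow> fcauchy X \<and> fcauchy Y \<and> (\<lambda>n. cuntz_norm (X n - Y n)) \<longlonglongrightarrow> 0"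

lemma null_le:
  assumes "g \<longlonglongrightarrow> (0::real)" "\<And>n. 0 \<le> f n" "\<And>n. f n \<le> g n"
  shows "f \<longlonglongrightarrow> 0"
  by (rule tendsto_sandwich[OF _ _ tendsto_const assms(1)]) (auto simp: assms)

lemma fcauchy_const: "fcauchy (\<lambda>n. p)"
  by (simp add: fcauchy_def cuntz_norm_zero)

lemma fcauchy_bounded:
  assumes "fcauchy X"
  shows "\<exists>B>0. \<forall>n. cuntz_norm (X n) \<le> B"
proof -
  obtain M where M: "\<And>m n. m \<ge> M \<Longrightarrow> n \<ge> M \<Longrightarrow> cuntz_norm (X m - X n) < 1"
    using assms unfolding fcauchy_def by (meson zero_less_one)
  define B where "B = (\<Sum>k\<le>M. cuntz_norm (X k)) + 1"
  have s: "cuntz_norm (X k) \<le> (\<Sum>k\<le>M. cuntz_norm (X k))" if "k \<le> M" for k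
    by (rule member_le_sum) (auto simp: that cuntz_norm_nonneg)
  have "cuntz_norm (X n) \<le> B" for n
  proof (cases "n \<le> M")
    case True
    then show ?thesis using s[of n] by (simp add: B_def)
  next
    case False
    then show ?thesis
      using M[of n M] s[of M] cuntz_norm_triangle[of "X n - X M" "X M"] by (simp add: B_def)
  qed
  moreover have "B > 0"
    unfolding B_def by (intro add_nonneg_pos sum_nonneg cuntz_norm_nonneg) simp
  ultimately show ?thesis by blast
qed

lemma fcauchy_add:
  assumes "fcauchy X" "fcauchy Y"
  shows "fcauchy (\<lambda>n. X n + Y n)"
  unfolding fcauchy_def
proof (intro allI impI)
  fix e :: real assume "e > 0"
  then obtain M N where MN: "\<And>m n. m \<ge> M \<Longrightarrow> n \<ge> M \<Longrightarrow> cuntz_norm (X m - X n) < e / 2"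
    "\<And>m n. m \<ge> N \<Longrightarrow> n \<ge> N \<Longrightarrow> cuntz_norm (Y m - Y n) < e / 2"
    using assms unfolding fcauchy_def by (meson half_gt_zero)
  have "cuntz_norm ((X m + Y m) - (X n + Y n)) < e" if "m \<ge> max M N" "n \<ge> max M N" for m n
    using MN(1)[of m n] MN(2)[of m n] that cuntz_norm_add_diff[of "X m" "Y m" "X n" "Y n"] by simp
  then show "\<exists>M. \<forall>m\<ge>M. \<forall>n\<ge>M. cuntz_norm ((X m + Y m) - (X n + Y n)) < e" by blast
qed

lemma fcauchy_mult:
  assumes "fcauchy X" "fcauchy Y"
  shows "fcauchy (\<lambda>n. X n * Y n)"
  unfolding fcauchy_def
proof (intro allI impI)
  fix e :: real assume e: "e > 0"
  obtain B C where B: "B > 0" "\<And>n. cuntz_norm (X n) \<le> B" and C: "C > 0" "\<And>n. cuntz_norm (Y n) \<le> C"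
    using fcauchy_bounded assms by metis
  have "e / (2 * B) > 0" "e / (2 * C) > 0" using e B C by simp_all
  then obtain M N where MN: "\<And>m n. m \<ge> M \<Longrightarrow> n \<ge> M \<Longrightarrow> cuntz_norm (X m - X n) < e / (2 * C)"
    "\<And>m n. m \<ge> N \<Longrightarrow> n \<ge> N \<Longrightarrow> cuntz_norm (Y m - Y n) < e / (2 * B)"
    using assms unfolding fcauchy_def by meson
  have "cuntz_norm (X m * Y m - X n * Y n) < e" if "m \<ge> max M N" "n \<ge> max M N" for m n
  proof -
    have "cuntz_norm (X m) * cuntz_norm (Y m - Y n) \<le> B * cuntz_norm (Y m - Y n)"
      by (intro mult_right_mono B cuntz_norm_nonneg)
    also have "\<dots> < B * (e / (2 * B))" using MN(2)[of m n] that B by (intro mult_strict_left_mono) auto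
    also have "\<dots> = e / 2" using B by simp
    finally have 1: "cuntz_norm (X m) * cuntz_norm (Y m - Y n) < e / 2" .
    have "cuntz_norm (X m - X n) * cuntz_norm (Y n) \<le> cuntz_norm (X m - X n) * C"
      by (intro mult_left_mono C cuntz_norm_nonneg)
    also have "\<dots> < (e / (2 * C)) * C" using MN(1)[of m n] that C by (intro mult_strict_right_mono) auto
    also have "\<dots> = e / 2" using C by simp
    finally show ?thesis
      using 1 cuntz_norm_mult_diff[of "X m" "Y m" "X n" "Y n"] by linarith
  qed
  then show "\<exists>M. \<forall>m\<ge>M. \<forall>n\<ge>M. cuntz_norm (X m * Y m - X n * Y n) < e" by blast
qed

lemma fcauchy_fstar: "fcauchy X \<Longrightarrow> fcauchy (\<lambda>n. fstar (X n))"
  by (simp add: fcauchy_def cuntz_norm_fstar flip: fstar_minus)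

lemma fcauchy_fscale: "fcauchy X \<Longrightarrow> fcauchy (\<lambda>n. fscale c (X n))"
  unfolding fscale_def by (intro fcauchy_mult fcauchy_const)

lemma fcauchy_uminus: "fcauchy X \<Longrightarrow> fcauchy (\<lambda>n. - X n)"
  using fcauchy_fscale[of X "- 1"] by (simp add: fscale_minus_one)

lemma fcauchy_diff: "fcauchy X \<Longrightarrow> fcauchy Y \<Longrightarrow> fcauchy (\<lambda>n. X n - Y n)"
  using fcauchy_add[of X "\<lambda>n. - Y n"] fcauchy_uminus[of Y] by simp

lemma fcauchy_norm_LIMSEQ:
  assumes "fcauchy X"
  shows "(\<lambda>n. cuntz_norm (X n)) \<longlonglongrightarrow> lim (\<lambda>n. cuntz_norm (X n))"
proof -
  have "Cauchy (\<lambda>n. cuntz_norm (X n))"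
  proof (rule metric_CauchyI)
    fix e :: real assume "0 < e"
    then obtain M where "\<And>m n. m \<ge> M \<Longrightarrow> n \<ge> M \<Longrightarrow> cuntz_norm (X m - X n) < e"
      using assms unfolding fcauchy_def by blast
    then show "\<exists>M. \<forall>m\<ge>M. \<forall>n\<ge>M. dist (cuntz_norm (X m)) (cuntz_norm (X n)) < e"
      using cuntz_norm_abs_diff by (metis dist_real_def order_le_less_trans)
  qed
  then show ?thesis using Cauchy_convergent convergent_LIMSEQ_iff by blast
qed

lemma frel_refl: "frel X X \<longleftrightarrow> fcauchy X"
  by (simp add: frel_def cuntz_norm_zero)

lemma frelD: "frel X Y \<Longrightarrow> fcauchy X" "frel X Y \<Longrightarrow> fcauchy Y"
  "frel X Y \<Longrightarrow> (\<lambda>n. cuntz_norm (X n - Y n)) \<longlonglongrightarrow> 0"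
  by (simp_all add: frel_def)

lemma part_equivp_frel: "part_equivp (frel :: (nat \<Rightarrow> 'n::finite free_alg) \<Rightarrow> _)"
proof (rule part_equivpI)
  show "\<exists>X. frel X (X :: nat \<Rightarrow> 'n free_alg)"
    using fcauchy_const frel_refl by blast
  show "symp (frel :: (nat \<Rightarrow> 'n free_alg) \<Rightarrow> _)"
    by (intro sympI) (simp add: frel_def cuntz_norm_minus_commute)
  show "transp (frel :: (nat \<Rightarrow> 'n free_alg) \<Rightarrow> _)"
  proof (rule transpI)
    fix X Y Z :: "nat \<Rightarrow> 'n free_alg" assume a: "frel X Y" "frel Y Z"
    have "(\<lambda>n. cuntz_norm (X n - Z n)) \<longlonglongrightarrow> 0"
      by (rule null_le[OF tendsto_add[OF frelD(3)[OF a(1)] frelD(3)[OF a(2)], simplified]])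
         (auto simp: cuntz_norm_nonneg cuntz_norm_triangle3)
    then show "frel X Z" using a by (simp add: frel_def)
  qed
qed

lemma frel_add:
  assumes "frel X X'" "frel Y Y'"
  shows "frel (\<lambda>n. X n + Y n) (\<lambda>n. X' n + Y' n)"
proof -
  have "(\<lambda>n. cuntz_norm ((X n + Y n) - (X' n + Y' n))) \<longlonglongrightarrow> 0"
    by (rule null_le[OF tendsto_add[OF frelD(3)[OF assms(1)] frelD(3)[OF assms(2)], simplified]])
       (auto simp: cuntz_norm_nonneg cuntz_norm_add_diff)
  then show ?thesis using assms by (simp add: frel_def fcauchy_add)
qed

lemma frel_mult:
  assumes "frel X X'" "frel Y Y'"
  shows "frel (\<lambda>n. X n * Y n) (\<lambda>n. X' n * Y' n)"
proof -
  obtain B where B: "\<And>n. cuntz_norm (X n) \<le> B" using fcauchy_bounded frelD(1)[OF assms(1)] by blast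
  obtain C where C: "\<And>n. cuntz_norm (Y' n) \<le> C" using fcauchy_bounded frelD(2)[OF assms(2)] by blast
  have l: "(\<lambda>n. B * cuntz_norm (Y n - Y' n) + cuntz_norm (X n - X' n) * C) \<longlonglongrightarrow> 0"
    using tendsto_add[OF tendsto_mult[OF tendsto_const frelD(3)[OF assms(2)]]
        tendsto_mult[OF frelD(3)[OF assms(1)] tendsto_const]] by simp
  have "(\<lambda>n. cuntz_norm (X n * Y n - X' n * Y' n)) \<longlonglongrightarrow> 0"
  proof (rule null_le[OF l])
    fix n
    show "cuntz_norm (X n * Y n - X' n * Y' n) \<le> B * cuntz_norm (Y n - Y' n) + cuntz_norm (X n - X' n) * C"
      by (rule order_trans[OF cuntz_norm_mult_diff])
         (intro add_mono mult_right_mono mult_left_mono B C cuntz_norm_nonneg)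
  qed (rule cuntz_norm_nonneg)
  then show ?thesis using assms by (simp add: frel_def fcauchy_mult)
qed

lemma frel_fscale: "frel X Y \<Longrightarrow> frel (\<lambda>n. fscale c (X n)) (\<lambda>n. fscale c (Y n))"
  unfolding fscale_def by (intro frel_mult) (simp_all add: frel_refl fcauchy_const)

lemma frel_uminus: "frel X Y \<Longrightarrow> frel (\<lambda>n. - X n) (\<lambda>n. - Y n)"
  using frel_fscale[of X Y "- 1"] by (simp add: fscale_minus_one)

lemma frel_diff: "frel X X' \<Longrightarrow> frel Y Y' \<Longrightarrow> frel (\<lambda>n. X n - Y n) (\<lambda>n. X' n - Y' n)"
  using frel_add[OF _ frel_uminus, of X X' Y Y'] by simp

lemma frel_fstar: "frel X Y \<Longrightarrow> frel (\<lambda>n. fstar (X n)) (\<lambda>n. fstar (Y n))"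
  by (simp add: frel_def fcauchy_fstar cuntz_norm_fstar flip: fstar_minus)

lemma frel_norm:
  assumes "frel X Y"
  shows "lim (\<lambda>n. cuntz_norm (X n)) = lim (\<lambda>n. cuntz_norm (Y n))"
proof -
  have "(\<lambda>n. cuntz_norm (X n) - cuntz_norm (Y n)) \<longlonglongrightarrow> 0"
    by (rule Lim_null_comparison[OF _ frelD(3)[OF assms]]) (simp add: cuntz_norm_abs_diff)
  moreover have "(\<lambda>n. cuntz_norm (X n) - cuntz_norm (Y n)) \<longlonglongrightarrow>
      lim (\<lambda>n. cuntz_norm (X n)) - lim (\<lambda>n. cuntz_norm (Y n))"
    using assms by (intro tendsto_diff fcauchy_norm_LIMSEQ) (auto simp: frel_def)
  ultimately show ?thesis using LIMSEQ_unique by fastforce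
qed

text \<open>\<open>'n cuntz\<close> is the Cuntz algebra on \<open>CARD('n)\<close> generators: null sequences are divided out
  together with the null ideal of the universal seminorm.\<close>

quotient_type (overloaded) 'n cuntz = "nat \<Rightarrow> 'n::finite free_alg" / partial: frel
  by (rule part_equivp_frel)

instantiation cuntz :: (finite) "{zero, one, plus, minus, uminus, times, scaleC, scaleR, star}"
begin
lift_definition zero_cuntz :: "'a cuntz" is "\<lambda>n. 0" by (simp add: frel_refl fcauchy_const)
lift_definition one_cuntz :: "'a cuntz" is "\<lambda>n. 1" by (simp add: frel_refl fcauchy_const)
lift_definition plus_cuntz :: "'a cuntz \<Rightarrow> 'a cuntz \<Rightarrow> 'a cuntz" is "\<lambda>X Y n. X n + Y n"
  by (rule frel_add)
lift_definition minus_cuntz :: "'a cuntz \<Rightarrow> 'a cuntz \<Rightarrow> 'a cuntz" is "\<lambda>X Y n. X n - Y n"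
  by (rule frel_diff)
lift_definition uminus_cuntz :: "'a cuntz \<Rightarrow> 'a cuntz" is "\<lambda>X n. - X n"
  by (rule frel_uminus)
lift_definition times_cuntz :: "'a cuntz \<Rightarrow> 'a cuntz \<Rightarrow> 'a cuntz" is "\<lambda>X Y n. X n * Y n"
  by (rule frel_mult)
lift_definition scaleC_cuntz :: "complex \<Rightarrow> 'a cuntz \<Rightarrow> 'a cuntz" is "\<lambda>c X n. fscale c (X n)"
  by (rule frel_fscale)
lift_definition star_cuntz :: "'a cuntz \<Rightarrow> 'a cuntz" is "\<lambda>X n. fstar (X n)"
  by (rule frel_fstar)
definition scaleR_cuntz :: "real \<Rightarrow> 'a cuntz \<Rightarrow> 'a cuntz" where
  "scaleR_cuntz r x = complex_of_real r *\<^sub>C x"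
instance ..
end

lift_definition cnorm :: "'n::finite cuntz \<Rightarrow> real" is "\<lambda>X. lim (\<lambda>n. cuntz_norm (X n))"
  by (rule frel_norm)

lemma cnorm_LIMSEQ:
  "fcauchy X \<Longrightarrow> (\<lambda>n. cuntz_norm (X n)) \<longlonglongrightarrow> cnorm (abs_cuntz X)"
  by (simp add: cnorm.abs_eq frel_refl fcauchy_norm_LIMSEQ)

lemma cuntz_abs_cases:
  obtains X where "x = abs_cuntz X" "fcauchy X"
  using that[of "rep_cuntz x"] Quotient3_abs_rep[OF Quotient3_cuntz, of x]
    Quotient3_rep_reflp[OF Quotient3_cuntz, of x] by (simp add: frel_refl)

lemma cnorm_nonneg: "0 \<le> cnorm (x :: 'n::finite cuntz)"
  by (rule cuntz_abs_cases[of x])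
     (auto intro!: LIMSEQ_le_const[OF cnorm_LIMSEQ] simp: cuntz_norm_nonneg)

lemma cnorm_mult_le: "cnorm (x * y) \<le> cnorm x * cnorm (y :: 'n::finite cuntz)"
proof -
  obtain X Y where XY: "x = abs_cuntz X" "fcauchy X" "y = abs_cuntz Y" "fcauchy Y"
    using cuntz_abs_cases by metis
  have "(\<lambda>n. cuntz_norm (X n * Y n)) \<longlonglongrightarrow> cnorm (x * y)"
    using XY cnorm_LIMSEQ[OF fcauchy_mult[OF XY(2,4)]]
    by (simp add: times_cuntz.abs_eq frel_refl)
  moreover have "(\<lambda>n. cuntz_norm (X n) * cuntz_norm (Y n)) \<longlonglongrightarrow> cnorm x * cnorm y"
    using XY by (auto intro!: tendsto_mult cnorm_LIMSEQ)
  ultimately show ?thesis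
    by (rule LIMSEQ_le) (auto intro: cuntz_norm_mult)
qed

lemma cnorm_triangle: "cnorm (x + y) \<le> cnorm x + cnorm (y :: 'n::finite cuntz)"
proof -
  obtain X Y where XY: "x = abs_cuntz X" "fcauchy X" "y = abs_cuntz Y" "fcauchy Y"
    using cuntz_abs_cases by metis
  have "(\<lambda>n. cuntz_norm (X n + Y n)) \<longlonglongrightarrow> cnorm (x + y)"
    using XY cnorm_LIMSEQ[OF fcauchy_add[OF XY(2,4)]]
    by (simp add: plus_cuntz.abs_eq frel_refl)
  moreover have "(\<lambda>n. cuntz_norm (X n) + cuntz_norm (Y n)) \<longlonglongrightarrow> cnorm x + cnorm y"
    using XY by (auto intro!: tendsto_add cnorm_LIMSEQ)
  ultimately show ?thesis
    by (rule LIMSEQ_le) (auto intro: cuntz_norm_triangle)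
qed

lemma cnorm_scaleC: "cnorm (c *\<^sub>C x) = cmod c * cnorm (x :: 'n::finite cuntz)"
proof -
  obtain X where X: "x = abs_cuntz X" "fcauchy X" using cuntz_abs_cases by metis
  have "(\<lambda>n. cuntz_norm (fscale c (X n))) \<longlonglongrightarrow> cnorm (c *\<^sub>C x)"
    using X cnorm_LIMSEQ[OF fcauchy_fscale[OF X(2)]]
    by (simp add: scaleC_cuntz.abs_eq frel_refl)
  moreover have "(\<lambda>n. cuntz_norm (fscale c (X n))) \<longlonglongrightarrow> cmod c * cnorm x"
    unfolding cuntz_norm_fscale using X by (auto intro!: tendsto_mult cnorm_LIMSEQ)
  ultimately show ?thesis by (rule LIMSEQ_unique)
qed

lemma cnorm_star_mult: "cnorm (x\<^sup>\<star> * x) = (cnorm (x :: 'n::finite cuntz))\<^sup>2"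
proof -
  obtain X where X: "x = abs_cuntz X" "fcauchy X" using cuntz_abs_cases by metis
  have "(\<lambda>n. cuntz_norm (fstar (X n) * X n)) \<longlonglongrightarrow> cnorm (x\<^sup>\<star> * x)"
    using X cnorm_LIMSEQ[OF fcauchy_mult[OF fcauchy_fstar[OF X(2)] X(2)]]
    by (simp add: star_cuntz.abs_eq times_cuntz.abs_eq frel_refl fcauchy_fstar)
  moreover have "(\<lambda>n. cuntz_norm (fstar (X n) * X n)) \<longlonglongrightarrow> (cnorm x)\<^sup>2"
    unfolding cuntz_norm_fstar_mult using X by (auto intro!: tendsto_power cnorm_LIMSEQ)
  ultimately show ?thesis by (rule LIMSEQ_unique)
qed

lemma cnorm_eq_0: "cnorm x = 0 \<longleftrightarrow> x = (0 :: 'n::finite cuntz)"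
proof
  assume n: "cnorm x = 0"
  obtain X where X: "x = abs_cuntz X" "fcauchy X" using cuntz_abs_cases by metis
  have "frel X (\<lambda>n. 0)"
    using cnorm_LIMSEQ[OF X(2)] n X by (simp add: frel_def fcauchy_const)
  then show "x = 0"
    using X Quotient3_rel_abs[OF Quotient3_cuntz] by (simp add: zero_cuntz_def)
next
  assume "x = 0"
  then show "cnorm x = 0" using cnorm_scaleC[of 0 x]
    by (simp add: zero_cuntz.abs_eq scaleC_cuntz.abs_eq frel_refl fcauchy_const)
qed

lemma frel_reflI: "(\<And>n. X n = Y n) \<Longrightarrow> fcauchy X \<Longrightarrow> frel X Y"
  by (metis ext frel_refl)

instance cuntz :: (finite) ring_1
proof
  fix a b c :: "'a cuntz"
  show "a + b + c = a + (b + c)" "a + b = b + a" "0 + a = a" "- a + a = 0" "a - b = a + - b"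
    "a * b * c = a * (b * c)" "1 * a = a" "a * 1 = a" "(a + b) * c = a * c + b * c"
    "a * (b + c) = a * b + a * c"
    by (transfer, rule frel_reflI;
        simp add: frel_refl algebra_simps fcauchy_add fcauchy_mult fcauchy_diff fcauchy_const)+
  show "(0::'a cuntz) \<noteq> 1"
  proof
    assume "(0::'a cuntz) = 1"
    then have "cnorm (0::'a cuntz) = cnorm (1::'a cuntz)" by simp
    moreover have "cnorm (1::'a cuntz) = 1"
      by transfer (simp add: cuntz_norm_one)
    ultimately show False by (metis cnorm_eq_0 zero_neq_one)
  qed
qed

lemma scaleC_cuntz_axioms:
  fixes x y :: "'n::finite cuntz"
  shows "c *\<^sub>C (x + y) = c *\<^sub>C x + c *\<^sub>C y" "(c + d) *\<^sub>C x = c *\<^sub>C x + d *\<^sub>C x"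
    "c *\<^sub>C d *\<^sub>C x = (c * d) *\<^sub>C x" "1 *\<^sub>C x = x"
    "(c *\<^sub>C x) * y = c *\<^sub>C (x * y)" "x * (c *\<^sub>C y) = c *\<^sub>C (x * y)"
    "(x\<^sup>\<star>)\<^sup>\<star> = x" "(x + y)\<^sup>\<star> = x\<^sup>\<star> + y\<^sup>\<star>" "(c *\<^sub>C x)\<^sup>\<star> = cnj c *\<^sub>C x\<^sup>\<star>"
    "(x * y)\<^sup>\<star> = y\<^sup>\<star> * x\<^sup>\<star>"
  by (transfer, rule frel_reflI;
      simp add: frel_refl fcauchy_add fcauchy_mult fcauchy_fscale fcauchy_fstar fscale_add_right
        fscale_add_left fscale_fscale mult_fscale_left mult_fscale_right fstar_add fstar_fscale
        fstar_mult)+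

instantiation cuntz :: (finite) real_normed_algebra_1
begin
definition norm_cuntz :: "'a cuntz \<Rightarrow> real" where
  "norm_cuntz = cnorm"
definition dist_cuntz :: "'a cuntz \<Rightarrow> 'a cuntz \<Rightarrow> real" where
  "dist_cuntz x y = norm (x - y)"
definition sgn_cuntz :: "'a cuntz \<Rightarrow> 'a cuntz" where
  "sgn_cuntz x = inverse (norm x) *\<^sub>R x"
definition uniformity_cuntz :: "('a cuntz \<times> 'a cuntz) filter" where
  "uniformity_cuntz = (INF e\<in>{0<..}. principal {(x, y). dist x y < e})"
definition open_cuntz :: "'a cuntz set \<Rightarrow> bool" where
  "open_cuntz U \<longleftrightarrow> (\<forall>x\<in>U. \<forall>\<^sub>F (x', y) in uniformity. x' = x \<longrightarrow> y \<in> U)"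
instance
proof
  fix x y :: "'a cuntz" and r s :: real
  show "r *\<^sub>R (x + y) = r *\<^sub>R x + r *\<^sub>R y" "(r + s) *\<^sub>R x = r *\<^sub>R x + s *\<^sub>R x"
    "r *\<^sub>R s *\<^sub>R x = (r * s) *\<^sub>R x" "1 *\<^sub>R x = x"
    "(r *\<^sub>R x) * y = r *\<^sub>R (x * y)" "x * (r *\<^sub>R y) = r *\<^sub>R (x * y)"
    by (simp_all add: scaleR_cuntz_def scaleC_cuntz_axioms)
  show "norm x = 0 \<longleftrightarrow> x = 0" unfolding norm_cuntz_def by (rule cnorm_eq_0)
  show "norm (x + y) \<le> norm x + norm y" unfolding norm_cuntz_def by (rule cnorm_triangle)
  show "norm (r *\<^sub>R x) = \<bar>r\<bar> * norm x" by (simp add: norm_cuntz_def scaleR_cuntz_def cnorm_scaleC)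
  show "norm (x * y) \<le> norm x * norm y" unfolding norm_cuntz_def by (rule cnorm_mult_le)
  show "norm (1::'a cuntz) = 1" unfolding norm_cuntz_def by transfer (simp add: cuntz_norm_one)
  show "dist x y = norm (x - y)" by (rule dist_cuntz_def)
  show "sgn x = x /\<^sub>R norm x" by (rule sgn_cuntz_def)
  show "uniformity = (INF e\<in>{0<..}. principal {(x, y). dist x (y::'a cuntz) < e})"
    by (rule uniformity_cuntz_def)
  show "open U = (\<forall>x\<in>U. \<forall>\<^sub>F (x', y) in uniformity. x' = x \<longrightarrow> y \<in> U)" for U :: "'a cuntz set"
    by (rule open_cuntz_def)
qed
end

lemma norm_cuntz_LIMSEQ: "fcauchy X \<Longrightarrow> (\<lambda>n. cuntz_norm (X n)) \<longlonglongrightarrow> norm (abs_cuntz X)"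
  unfolding norm_cuntz_def by (rule cnorm_LIMSEQ)

definition cuntz_of :: "'n::finite free_alg \<Rightarrow> 'n cuntz" where
  "cuntz_of p = abs_cuntz (\<lambda>n. p)"

lemma cuntz_of_simps:
  "cuntz_of 0 = 0" "cuntz_of 1 = 1" "cuntz_of (p + q) = cuntz_of p + cuntz_of q"
  "cuntz_of (p - q) = cuntz_of p - cuntz_of q"
  "cuntz_of (p * q) = cuntz_of p * cuntz_of q" "cuntz_of (fscale c p) = c *\<^sub>C cuntz_of p"
  "cuntz_of (fstar p) = (cuntz_of p)\<^sup>\<star>" "norm (cuntz_of p) = cuntz_norm p"
  by (simp_all add: cuntz_of_def norm_cuntz_def zero_cuntz.abs_eq one_cuntz.abs_eq plus_cuntz.abs_eq
      minus_cuntz.abs_eq times_cuntz.abs_eq scaleC_cuntz.abs_eq star_cuntz.abs_eq cnorm.abs_eq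
      frel_refl fcauchy_const)

lemma cuntz_of_sum: "cuntz_of (sum f A) = (\<Sum>a\<in>A. cuntz_of (f a))"
  by (induction A rule: infinite_finite_induct) (auto simp: cuntz_of_simps)

lemma cuntz_of_LIMSEQ:
  assumes X: "fcauchy X"
  shows "(\<lambda>n. cuntz_of (X n)) \<longlonglongrightarrow> abs_cuntz X"
proof (rule metric_LIMSEQ_I)
  fix e :: real assume "0 < e"
  then obtain M where M: "\<And>m n. m \<ge> M \<Longrightarrow> n \<ge> M \<Longrightarrow> cuntz_norm (X m - X n) < e / 2"
    using X unfolding fcauchy_def by (meson half_gt_zero)
  have "dist (cuntz_of (X m)) (abs_cuntz X) < e" if "m \<ge> M" for m
  proof -
    have c: "fcauchy (\<lambda>n. X m - X n)" by (intro fcauchy_diff fcauchy_const X)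
    have "cuntz_of (X m) - abs_cuntz X = abs_cuntz (\<lambda>n. X m - X n)"
      using X by (simp add: cuntz_of_def minus_cuntz.abs_eq frel_refl fcauchy_const)
    then have "(\<lambda>n. cuntz_norm (X m - X n)) \<longlonglongrightarrow> dist (cuntz_of (X m)) (abs_cuntz X)"
      using norm_cuntz_LIMSEQ[OF c] by (simp add: dist_norm)
    moreover have "\<exists>N. \<forall>n\<ge>N. cuntz_norm (X m - X n) \<le> e / 2"
      using M[OF that] less_imp_le by blast
    ultimately have "dist (cuntz_of (X m)) (abs_cuntz X) \<le> e / 2" by (rule LIMSEQ_le_const2)
    then show ?thesis using \<open>0 < e\<close> by simp
  qed
  then show "\<exists>M. \<forall>m\<ge>M. dist (cuntz_of (X m)) (abs_cuntz X) < e" by blast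
qed

lemma cuntz_of_dense: "\<exists>X. fcauchy X \<and> (\<lambda>n. cuntz_of (X n)) \<longlonglongrightarrow> (x :: 'n::finite cuntz)"
  by (metis cuntz_abs_cases cuntz_of_LIMSEQ)

lemma closure_range_cuntz_of: "closure (range cuntz_of) = (UNIV :: 'n::finite cuntz set)"
proof -
  have "x \<in> closure (range cuntz_of)" for x :: "'n cuntz"
  proof -
    obtain X where "(\<lambda>n. cuntz_of (X n)) \<longlonglongrightarrow> x" using cuntz_of_dense by blast
    then show ?thesis
      unfolding closure_sequential by (intro exI[of _ "\<lambda>n. cuntz_of (X n)"]) simp
  qed
  then show ?thesis by blast
qed

instance cuntz :: (finite) banach
proof
  fix Z :: "nat \<Rightarrow> 'a cuntz" assume Z: "Cauchy Z"
  have "\<exists>p. dist (Z n) (cuntz_of p) < inverse (real (Suc n))" for n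
  proof -
    have "Z n \<in> closure (range cuntz_of)" by (simp add: closure_range_cuntz_of)
    then obtain p where "dist (cuntz_of p) (Z n) < inverse (real (Suc n))"
      unfolding closure_approachable by (metis imageE inverse_positive_iff_positive of_nat_0_less_iff zero_less_Suc)
    then show ?thesis by (metis dist_commute)
  qed
  then obtain P where P: "\<And>n. dist (Z n) (cuntz_of (P n)) < inverse (real (Suc n))" by metis
  have ZP: "(\<lambda>n. dist (Z n) (cuntz_of (P n))) \<longlonglongrightarrow> 0"
    by (rule null_le[OF LIMSEQ_inverse_real_of_nat]) (rule zero_le_dist, rule less_imp_le, rule P)
  have "fcauchy P"
    unfolding fcauchy_def
  proof (intro allI impI)
    fix e :: real assume "0 < e"
    then have e3: "0 < e / 3" by simp
    obtain M where M: "\<And>m n. m \<ge> M \<Longrightarrow> n \<ge> M \<Longrightarrow> dist (Z m) (Z n) < e / 3"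
      using Z e3 unfolding Cauchy_def by blast
    obtain N where N: "\<And>n. n \<ge> N \<Longrightarrow> dist (Z n) (cuntz_of (P n)) < e / 3"
      using metric_LIMSEQ_D[OF ZP e3] by auto
    have "cuntz_norm (P m - P n) < e" if "m \<ge> max M N" "n \<ge> max M N" for m n
    proof -
      have "cuntz_norm (P m - P n) = dist (cuntz_of (P m)) (cuntz_of (P n))"
        by (simp add: dist_norm flip: cuntz_of_simps)
      also have "\<dots> \<le> dist (cuntz_of (P m)) (Z m) + dist (Z m) (Z n) + dist (Z n) (cuntz_of (P n))"
        using dist_triangle[of "cuntz_of (P m)" "cuntz_of (P n)" "Z m"]
          dist_triangle[of "Z m" "cuntz_of (P n)" "Z n"] by linarith
      also have "\<dots> < e / 3 + e / 3 + e / 3"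
        using M[of m n] N[of m] N[of n] that by (simp add: dist_commute)
      finally show ?thesis by simp
    qed
    then show "\<exists>M. \<forall>m\<ge>M. \<forall>n\<ge>M. cuntz_norm (P m - P n) < e" by blast
  qed
  then have "(\<lambda>n. dist (cuntz_of (P n)) (abs_cuntz P)) \<longlonglongrightarrow> 0"
    by (intro tendsto_dist_iff[THEN iffD1] cuntz_of_LIMSEQ)
  from tendsto_add[OF ZP this]
  have l: "(\<lambda>n. dist (Z n) (cuntz_of (P n)) + dist (cuntz_of (P n)) (abs_cuntz P)) \<longlonglongrightarrow> 0"
    by simp
  have "(\<lambda>n. dist (Z n) (abs_cuntz P)) \<longlonglongrightarrow> 0"
    by (rule null_le[OF l]) (auto intro: dist_triangle)
  then have "Z \<longlonglongrightarrow> abs_cuntz P" by (rule tendsto_dist_iff[THEN iffD2])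
  then show "convergent Z" by (auto simp: convergent_def)
qed

instance cuntz :: (finite) cstar_algebra
proof
  fix x y :: "'a cuntz" and r :: real and c d :: complex
  show "r *\<^sub>R x = complex_of_real r *\<^sub>C x" by (rule scaleR_cuntz_def)
  show "norm (c *\<^sub>C x) = cmod c * norm x" unfolding norm_cuntz_def by (rule cnorm_scaleC)
  show "norm (x\<^sup>\<star> * x) = (norm x)\<^sup>2" unfolding norm_cuntz_def by (rule cnorm_star_mult)
qed (rule scaleC_cuntz_axioms)+

section \<open>Automatic continuity\<close>

lemma scaleC_zero [simp]: "c *\<^sub>C (0::'a::cstar_algebra) = 0"
  using scaleC_add_right[of c 0 "0::'a"] by simp

lemma zero_scaleC [simp]: "0 *\<^sub>C (x::'a::cstar_algebra) = 0"
  using scaleC_add_left[of 0 0 x] by simp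

lemma star_zero [simp]: "(0::'a::cstar_algebra)\<^sup>\<star> = 0"
  using star_add[of 0 "0::'a"] by simp

lemma star_one [simp]: "(1::'a::cstar_algebra)\<^sup>\<star> = 1"
  by (metis mult_1 mult_1_right star_mult star_star)

lemma star_scaleR: "(r *\<^sub>R (x::'a::cstar_algebra))\<^sup>\<star> = r *\<^sub>R x\<^sup>\<star>"
  by (simp add: scaleR_scaleC star_scaleC)

lemma star_uminus: "(- (x::'a::cstar_algebra))\<^sup>\<star> = - x\<^sup>\<star>"
  using star_scaleR[of "- 1" x] by simp

lemma star_diff: "((x::'a::cstar_algebra) - y)\<^sup>\<star> = x\<^sup>\<star> - y\<^sup>\<star>"
  by (metis add_uminus_conv_diff star_add star_uminus)

lemma norm_star: "norm ((x::'a::cstar_algebra)\<^sup>\<star>) = norm x"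
proof -
  have le: "norm y \<le> norm (y\<^sup>\<star>)" for y :: 'a
  proof (cases "norm y = 0")
    case False
    have "norm y * norm y \<le> norm (y\<^sup>\<star>) * norm y"
      using norm_mult_ineq[of "y\<^sup>\<star>" y] by (simp add: norm_star_mult_self power2_eq_square)
    then show ?thesis using False by simp
  qed simp
  show ?thesis using le[of x] le[of "x\<^sup>\<star>"] by (simp add: star_star)
qed

lemma bounded_linear_star: "bounded_linear (star :: 'a::cstar_algebra \<Rightarrow> 'a)"
  by (rule bounded_linear_intro[where K = 1]) (simp_all add: star_add star_scaleR norm_star)

lemma star_power: "((x::'a::cstar_algebra) ^ n)\<^sup>\<star> = (x\<^sup>\<star>) ^ n"
  by (induction n) (simp_all add: star_mult power_commutes)

lemma bounded_linear_scaleC: "bounded_linear (\<lambda>x::'a::cstar_algebra. c *\<^sub>C x)"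
  by (rule bounded_linear_intro[where K = "cmod c"])
     (simp_all add: scaleC_add_right scaleR_scaleC scaleC_scaleC mult.commute norm_scaleC)

lemma unital_star_homD:
  assumes "unital_star_hom \<phi>"
  shows "\<phi> (x + y) = \<phi> x + \<phi> y" "\<phi> (c *\<^sub>C x) = c *\<^sub>C \<phi> x" "\<phi> (x * y) = \<phi> x * \<phi> y"
    "\<phi> 1 = 1" "\<phi> (x\<^sup>\<star>) = (\<phi> x)\<^sup>\<star>"
  using assms unfolding unital_star_hom_def by blast+

lemma abs_half_gchoose_le: "\<bar>(1/2 :: real) gchoose n\<bar> \<le> 1"
proof (induction n)
  case (Suc n)
  have "(1/2 :: real) gchoose (Suc n) = ((1/2) gchoose n) * ((1/2 - real n) / real (Suc n))"
    using gbinomial_mult_1[of "1/2::real" n] by (simp add: field_simps)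
  moreover have "\<bar>(1/2 - real n) / real (Suc n)\<bar> \<le> 1"
    by (simp add: field_simps abs_if)
  ultimately show ?case
    using Suc mult_mono[of "\<bar>(1/2::real) gchoose n\<bar>" 1 "\<bar>(1/2 - real n) / real (Suc n)\<bar>" 1]
    by (simp add: abs_mult)
qed simp

text \<open>A selfadjoint contraction is the real part of a unitary.\<close>

lemma selfadjoint_sqrt:
  fixes a :: "'a::cstar_algebra"
  assumes "a\<^sup>\<star> = a" "norm a < 1"
  obtains c where "c\<^sup>\<star> = c" "c * c = 1 - a * a" "c * a = a * c"
proof -
  define b where "b = - (a * a)"
  define f where "f n = ((1/2 :: real) gchoose n) *\<^sub>R b ^ n" for n
  have nb: "norm b < 1"
  proof -
    have "norm b = (norm a)\<^sup>2" using norm_star_mult_self[of a] assms by (simp add: b_def)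
    then show ?thesis using assms by (simp add: power_less_one_iff abs_square_less_1)
  qed
  have sn: "summable (\<lambda>n. norm (f n))"
  proof (rule summable_comparison_test'[where g = "\<lambda>n. norm b ^ n" and N = 0])
    show "summable (\<lambda>n. norm b ^ n)" using nb by (simp add: summable_geometric)
    fix n
    have "norm (f n) \<le> 1 * norm b ^ n"
      unfolding f_def norm_scaleR
      by (intro mult_mono abs_half_gchoose_le norm_power_ineq) auto
    then show "norm (norm (f n)) \<le> norm b ^ n" by simp
  qed
  then have s: "summable f" by (rule summable_norm_cancel)
  define c where "c = suminf f"
  have "c\<^sup>\<star> = suminf (\<lambda>n. (f n)\<^sup>\<star>)"
    unfolding c_def by (rule bounded_linear.suminf[OF bounded_linear_star s])
  moreover have "b\<^sup>\<star> = b" using assms by (simp add: b_def star_uminus star_mult)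
  then have "(f n)\<^sup>\<star> = f n" for n
    by (simp add: f_def star_scaleR star_power)
  ultimately have 1: "c\<^sup>\<star> = c"
    by (simp add: c_def)
  have "(\<lambda>k. \<Sum>i\<le>k. f i * f (k - i)) sums (c * c)"
    unfolding c_def by (rule Cauchy_product_sums[OF sn sn])
  moreover have "(\<Sum>i\<le>k. f i * f (k - i)) = ((1::real) gchoose k) *\<^sub>R b ^ k" for k
  proof -
    have "(\<Sum>i\<le>k. f i * f (k - i)) =
        (\<Sum>i\<le>k. ((1/2 :: real) gchoose i) * ((1/2) gchoose (k - i))) *\<^sub>R b ^ k"
      unfolding scaleR_sum_left
      by (rule sum.cong) (auto simp: f_def simp flip: power_add)
    then show ?thesis
      using gbinomial_Vandermonde[of "1/2::real" "1/2" k] by (simp add: atLeast0AtMost)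
  qed
  ultimately have "(\<lambda>k. ((1::real) gchoose k) *\<^sub>R b ^ k) sums (c * c)" by simp
  moreover have "(\<lambda>k. ((1::real) gchoose k) *\<^sub>R b ^ k) sums (\<Sum>k<2. ((1::real) gchoose k) *\<^sub>R b ^ k)"
  proof (rule sums_finite)
    fix k :: nat assume "k \<notin> {..<2}"
    then have "(1::real) gchoose k = 0"
      using binomial_gbinomial[of 1 k, where 'a = real] binomial_eq_0[of "Suc 0" k] by simp
    then show "((1::real) gchoose k) *\<^sub>R b ^ k = 0" by simp
  qed simp
  ultimately have 2: "c * c = 1 - a * a"
    using sums_unique2 by (fastforce simp: b_def numeral_2_eq_2)
  have ab: "b ^ n * a = a * b ^ n" for n
    by (rule power_commuting_commutes) (simp add: b_def mult.assoc)
  have "c * a = suminf (\<lambda>n. f n * a)"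
    unfolding c_def by (rule suminf_mult2[OF s])
  also have "\<dots> = suminf (\<lambda>n. a * f n)"
    by (simp add: f_def ab)
  also have "\<dots> = a * c"
    unfolding c_def by (rule suminf_mult[OF s])
  finally have 3: "c * a = a * c" .
  show ?thesis using that 1 2 3 by blast
qed

lemma norm_le_1_of_isometry: "u\<^sup>\<star> * u = 1 \<Longrightarrow> norm (u :: 'a::cstar_algebra) = 1"
  using norm_star_mult_self[of u] norm_ge_zero[of u] by (simp add: power2_eq_1_iff)

lemma unital_star_hom_norm_le:
  fixes \<phi> :: "'a::cstar_algebra \<Rightarrow> 'b::cstar_algebra"
  assumes "unital_star_hom \<phi>"
  shows "norm (\<phi> x) \<le> norm x"
proof -
  note h = unital_star_homD[OF assms]
  have hR: "\<phi> (r *\<^sub>R x) = r *\<^sub>R \<phi> x" for r x by (simp add: scaleR_scaleC h)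
  have sa1: "norm (\<phi> a) \<le> 1" if a: "a\<^sup>\<star> = a" "norm a < 1" for a
  proof -
    obtain c where c: "c\<^sup>\<star> = c" "c * c = 1 - a * a" "c * a = a * c"
      using selfadjoint_sqrt[OF a] by blast
    define u where "u = a + \<i> *\<^sub>C c"
    have us: "u\<^sup>\<star> = a + (- \<i>) *\<^sub>C c" by (simp add: u_def star_add star_scaleC a c)
    have e: "\<i> *\<^sub>C x + (- \<i>) *\<^sub>C x = 0" "(- \<i>) *\<^sub>C x + \<i> *\<^sub>C x = 0" for x :: 'a
      by (simp_all flip: scaleC_add_left)
    have m: "(a + d *\<^sub>C c) * (a + d' *\<^sub>C c) = a * a + (d' *\<^sub>C (a * c) + d *\<^sub>C (a * c)) + (d * d') *\<^sub>C (c * c)"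
      for d d'
      by (simp add: distrib_left distrib_right mult_scaleC_left mult_scaleC_right scaleC_scaleC c(3)
          scaleC_add_right mult.commute[of d' d] add_ac)
    have "u\<^sup>\<star> * u = 1" unfolding us unfolding u_def m by (simp add: e scaleC_one c(2))
    moreover have "u * u\<^sup>\<star> = 1" unfolding us unfolding u_def m by (simp add: e scaleC_one c(2))
    ultimately have "(\<phi> u)\<^sup>\<star> * \<phi> u = 1" "(\<phi> (u\<^sup>\<star>))\<^sup>\<star> * \<phi> (u\<^sup>\<star>) = 1"
      by (simp_all flip: h(3,5) add: h(4) star_star)
    then have n: "norm (\<phi> u) = 1" "norm (\<phi> (u\<^sup>\<star>)) = 1"
      by (auto intro: norm_le_1_of_isometry)
    have "u + u\<^sup>\<star> = a + a + (\<i> *\<^sub>C c + (- \<i>) *\<^sub>C c)" unfolding us by (simp add: u_def add_ac)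
    then have "u + u\<^sup>\<star> = 2 *\<^sub>R a" by (simp add: e scaleR_2)
    then have "2 * norm (\<phi> a) = norm (\<phi> u + \<phi> (u\<^sup>\<star>))" by (simp flip: h(1) add: hR)
    then show ?thesis using norm_triangle_ineq[of "\<phi> u" "\<phi> (u\<^sup>\<star>)"] n by simp
  qed
  have sa: "norm (\<phi> a) \<le> norm a" if a: "a\<^sup>\<star> = a" for a
  proof (rule dense_ge)
    fix t assume t: "norm a < t"
    then have "t > 0" using norm_ge_zero[of a] by linarith
    have "norm (\<phi> (inverse t *\<^sub>R a)) \<le> 1"
      using t \<open>t > 0\<close> by (intro sa1) (auto simp: star_scaleR a field_simps)
    then show "norm (\<phi> a) \<le> t" using \<open>t > 0\<close> by (simp add: hR field_simps)
  qed
  have "(norm (\<phi> x))\<^sup>2 = norm (\<phi> (x\<^sup>\<star> * x))" by (simp add: h norm_star_mult_self)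
  also have "\<dots> \<le> norm (x\<^sup>\<star> * x)" by (rule sa) (simp add: star_mult star_star)
  also have "\<dots> = (norm x)\<^sup>2" by (rule norm_star_mult_self)
  finally show ?thesis by (simp add: power2_le_iff_abs_le)
qed

section \<open>Canonical generators and the universal property\<close>

definition cuntz_family :: "('n::finite \<Rightarrow> 'a::cstar_algebra) \<Rightarrow> bool" where
  "cuntz_family t \<longleftrightarrow> (\<forall>i j. (t i)\<^sup>\<star> * t j = (if i = j then 1 else 0)) \<and> (\<Sum>i\<in>UNIV. t i * (t i)\<^sup>\<star>) = 1"

text \<open>For \<open>'n = 4\<close> the index set \<open>{1, 2, 3, 4}\<close> is all of the numeral type, with \<open>4 = 0\<close>.\<close>

definition cgen :: "'n::finite \<Rightarrow> 'n cuntz" where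
  "cgen i = cuntz_of (fgen i)"

theorem cuntz_family_cgen: "cuntz_family (cgen :: 'n::finite \<Rightarrow> 'n cuntz)"
proof -
  have 0: "cuntz_of p = cuntz_of q" if "cuntz_norm (p - q) = 0" for p q :: "'n free_alg"
    using that by (metis cuntz_of_simps(4,8) norm_eq_zero right_minus_eq)
  note r = cuntz_seminormD(2,3)[OF cuntz_seminorm_cuntz_norm, THEN 0]
  have "(cgen i)\<^sup>\<star> * cgen j = (if i = j then 1 else 0)" for i j :: 'n
    using r(1)[of i j] by (auto simp: cgen_def cuntz_of_simps split: if_splits)
  moreover have "(\<Sum>i\<in>UNIV. cgen i * (cgen i)\<^sup>\<star>) = (1 :: 'n cuntz)"
    using r(2) by (simp add: cgen_def cuntz_of_simps cuntz_of_sum)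
  ultimately show ?thesis by (simp add: cuntz_family_def)
qed

definition word_val :: "('n \<Rightarrow> 'a::cstar_algebra) \<Rightarrow> 'n free_word \<Rightarrow> 'a" where
  "word_val t w = prod_list (map (\<lambda>(i, b). if b then (t i)\<^sup>\<star> else t i) (letters w))"

definition free_val :: "('n \<Rightarrow> 'a::cstar_algebra) \<Rightarrow> 'n free_alg \<Rightarrow> 'a" where
  "free_val t = lin_ext (\<lambda>w c. c *\<^sub>C word_val t w)"

lemma word_val_plus: "word_val t (u + v) = word_val t u * word_val t v"
  by (simp add: word_val_def plus_free_word_def)

lemma word_val_star: "word_val t (word_star w) = (word_val t w)\<^sup>\<star>"
proof -
  have "prod_list (map (\<lambda>(i, b). if b then (t i)\<^sup>\<star> else t i) (rev (map (\<lambda>(i, b). (i, \<not> b)) l))) =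
      (prod_list (map (\<lambda>(i, b). if b then (t i)\<^sup>\<star> else t i) l))\<^sup>\<star>" for l
    by (induction l) (auto simp: star_mult star_star)
  then show ?thesis by (simp add: word_val_def word_star_def)
qed

lemma free_val_add: "free_val t (p + q) = free_val t p + free_val t q"
  unfolding free_val_def by (rule lin_ext_add) (rule scaleC_add_left)

lemma free_val_single: "free_val t (Poly_Mapping.single w c) = c *\<^sub>C word_val t w"
  unfolding free_val_def by (rule lin_ext_single) simp

lemma free_val_zero [simp]: "free_val t 0 = 0"
  by (simp add: free_val_def)

lemma free_val_one [simp]: "free_val t 1 = 1"
proof -
  have "word_val t 0 = 1" by (simp add: word_val_def zero_free_word_def)
  then show ?thesis using free_val_single[of t 0 1] by (simp add: scaleC_one)
qed

lemma free_val_gen: "free_val t (fgen i) = t i"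
  by (simp add: fgen_def free_val_single word_val_def scaleC_one)

lemma free_val_minus: "free_val t (p - q) = free_val t p - free_val t q"
  by (metis add_diff_cancel diff_add_cancel free_val_add)

lemma free_val_sum: "free_val t (sum f A) = (\<Sum>a\<in>A. free_val t (f a))"
  by (induction A rule: infinite_finite_induct) (auto simp: free_val_add)

lemma free_val_single_mult:
  "free_val t (Poly_Mapping.single w c * q) = free_val t (Poly_Mapping.single w c) * free_val t q"
  by (induction q rule: poly_mapping_add_induct)
     (simp_all add: distrib_left free_val_add mult_single free_val_single word_val_plus
        mult_scaleC_left mult_scaleC_right scaleC_scaleC mult.commute)

lemma free_val_mult: "free_val t (p * q) = free_val t p * free_val t q"
  by (induction p rule: poly_mapping_add_induct)
     (simp_all add: distrib_right free_val_add free_val_single_mult)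

lemma free_val_scale: "free_val t (fscale c p) = c *\<^sub>C free_val t p"
  by (induction p rule: poly_mapping_add_induct)
     (simp_all add: free_val_add fscale_add_right fscale_single free_val_single scaleC_add_right
        scaleC_scaleC, simp add: fscale_def)

lemma free_val_star: "free_val t (fstar p) = (free_val t p)\<^sup>\<star>"
  by (induction p rule: poly_mapping_add_induct)
     (simp_all add: free_val_add fstar_add fstar_single free_val_single star_add star_scaleC
        word_val_star)

lemma cuntz_seminorm_free_val:
  assumes "cuntz_family t"
  shows "cuntz_seminorm (\<lambda>p. norm (free_val t p))"
  using assms
  by (auto simp: cuntz_seminorm_def cstar_seminorm_def cuntz_family_def free_val_add free_val_scale
      free_val_mult free_val_star free_val_minus free_val_gen free_val_sum norm_scaleC
      norm_star_mult_self norm_triangle_ineq norm_mult_ineq)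

lemma norm_free_val_le: "cuntz_family t \<Longrightarrow> norm (free_val t p) \<le> cuntz_norm p"
  using cuntz_norm_upper[OF cuntz_seminorm_free_val] .

theorem cuntz_universal_exists:
  fixes t :: "'n::finite \<Rightarrow> 'a::cstar_algebra"
  assumes t: "cuntz_family t"
  shows "\<exists>\<phi>. unital_star_hom \<phi> \<and> (\<forall>i. \<phi> (cgen i) = t i)"
proof -
  define \<phi> where "\<phi> x = lim (\<lambda>n. free_val t (rep_cuntz x n))" for x
  have conv: "convergent (\<lambda>n. free_val t (X n))" if X: "fcauchy X" for X
  proof -
    have "Cauchy (\<lambda>n. free_val t (X n))"
    proof (rule metric_CauchyI)
      fix e :: real assume "0 < e"
      then obtain M where M: "\<And>m n. m \<ge> M \<Longrightarrow> n \<ge> M \<Longrightarrow> cuntz_norm (X m - X n) < e"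
        using X unfolding fcauchy_def by blast
      have "dist (free_val t (X m)) (free_val t (X n)) < e" if "m \<ge> M" "n \<ge> M" for m n
        using M[OF that] norm_free_val_le[OF t, of "X m - X n"] by (simp add: dist_norm free_val_minus)
      then show "\<exists>M. \<forall>m\<ge>M. \<forall>n\<ge>M. dist (free_val t (X m)) (free_val t (X n)) < e" by blast
    qed
    then show ?thesis by (rule Cauchy_convergent)
  qed
  have lim: "(\<lambda>n. free_val t (X n)) \<longlonglongrightarrow> \<phi> (abs_cuntz X)" if X: "fcauchy X" for X
  proof -
    define Y where "Y = rep_cuntz (abs_cuntz X)"
    have "frel Y X"
      unfolding Y_def using X by (intro Quotient3_rep_abs[OF Quotient3_cuntz]) (simp add: frel_refl)
    then have l0: "(\<lambda>n. cuntz_norm (X n - Y n)) \<longlonglongrightarrow> 0" and Y: "fcauchy Y"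
      by (auto simp: frel_def cuntz_norm_minus_commute)
    have "(\<lambda>n. free_val t (Y n)) \<longlonglongrightarrow> \<phi> (abs_cuntz X)"
      using conv[OF Y] by (simp add: \<phi>_def Y_def convergent_LIMSEQ_iff)
    moreover have "(\<lambda>n. free_val t (X n) - free_val t (Y n)) \<longlonglongrightarrow> 0"
      by (rule Lim_null_comparison[OF _ l0])
         (simp add: norm_free_val_le[OF t] flip: free_val_minus)
    ultimately show ?thesis using tendsto_add by fastforce
  qed
  have of: "\<phi> (cuntz_of p) = free_val t p" for p
    using lim[OF fcauchy_const[of p]] LIMSEQ_unique[OF _ tendsto_const] by (auto simp: cuntz_of_def LIMSEQ_const_iff)
  have "\<phi> (x + y) = \<phi> x + \<phi> y" for x y
  proof -
    obtain X Y where XY: "x = abs_cuntz X" "fcauchy X" "y = abs_cuntz Y" "fcauchy Y"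
      using cuntz_abs_cases by metis
    have "(\<lambda>n. free_val t (X n + Y n)) \<longlonglongrightarrow> \<phi> (x + y)"
      using lim[OF fcauchy_add[OF XY(2,4)]] XY by (simp add: plus_cuntz.abs_eq frel_refl)
    moreover have "(\<lambda>n. free_val t (X n + Y n)) \<longlonglongrightarrow> \<phi> x + \<phi> y"
      unfolding free_val_add using XY lim by (auto intro!: tendsto_add)
    ultimately show ?thesis by (rule LIMSEQ_unique)
  qed
  moreover have "\<phi> (x * y) = \<phi> x * \<phi> y" for x y
  proof -
    obtain X Y where XY: "x = abs_cuntz X" "fcauchy X" "y = abs_cuntz Y" "fcauchy Y"
      using cuntz_abs_cases by metis
    have "(\<lambda>n. free_val t (X n * Y n)) \<longlonglongrightarrow> \<phi> (x * y)"
      using lim[OF fcauchy_mult[OF XY(2,4)]] XY by (simp add: times_cuntz.abs_eq frel_refl)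
    moreover have "(\<lambda>n. free_val t (X n * Y n)) \<longlonglongrightarrow> \<phi> x * \<phi> y"
      unfolding free_val_mult using XY lim by (auto intro!: tendsto_mult)
    ultimately show ?thesis by (rule LIMSEQ_unique)
  qed
  moreover have "\<phi> (c *\<^sub>C x) = c *\<^sub>C \<phi> x" for c x
  proof -
    obtain X where X: "x = abs_cuntz X" "fcauchy X" using cuntz_abs_cases by metis
    have "(\<lambda>n. free_val t (fscale c (X n))) \<longlonglongrightarrow> \<phi> (c *\<^sub>C x)"
      using lim[OF fcauchy_fscale[OF X(2)]] X by (simp add: scaleC_cuntz.abs_eq frel_refl)
    moreover have "(\<lambda>n. free_val t (fscale c (X n))) \<longlonglongrightarrow> c *\<^sub>C \<phi> x"
      unfolding free_val_scale using X lim by (auto intro!: bounded_linear.tendsto[OF bounded_linear_scaleC])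
    ultimately show ?thesis by (rule LIMSEQ_unique)
  qed
  moreover have "\<phi> (x\<^sup>\<star>) = (\<phi> x)\<^sup>\<star>" for x
  proof -
    obtain X where X: "x = abs_cuntz X" "fcauchy X" using cuntz_abs_cases by metis
    have "(\<lambda>n. free_val t (fstar (X n))) \<longlonglongrightarrow> \<phi> (x\<^sup>\<star>)"
      using lim[OF fcauchy_fstar[OF X(2)]] X by (simp add: star_cuntz.abs_eq frel_refl)
    moreover have "(\<lambda>n. free_val t (fstar (X n))) \<longlonglongrightarrow> (\<phi> x)\<^sup>\<star>"
      unfolding free_val_star using X lim by (auto intro!: bounded_linear.tendsto[OF bounded_linear_star])
    ultimately show ?thesis by (rule LIMSEQ_unique)
  qed
  moreover have "\<phi> 1 = 1" using of[of 1] by (simp add: cuntz_of_simps)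
  moreover have "\<phi> (cgen i) = t i" for i by (simp add: cgen_def of free_val_gen)
  ultimately show ?thesis unfolding unital_star_hom_def by blast
qed

lemma cuntz_hom_eqI:
  fixes \<phi> \<psi> :: "'n::finite cuntz \<Rightarrow> 'a::cstar_algebra"
  assumes "unital_star_hom \<phi>" "unital_star_hom \<psi>" "\<And>i. \<phi> (cgen i) = \<psi> (cgen i)"
  shows "\<phi> = \<psi>"
proof
  fix x :: "'n cuntz"
  have poly: "\<phi> (cuntz_of p) = \<psi> (cuntz_of p)" for p
    by (induction p rule: free_alg_induct)
       (simp_all add: cuntz_of_simps unital_star_homD[OF assms(1)] unital_star_homD[OF assms(2)]
          assms(3)[unfolded cgen_def])
  have cont: "(\<lambda>n. \<theta> (X n)) \<longlonglongrightarrow> \<theta> y" if \<theta>: "unital_star_hom \<theta>" and X: "X \<longlonglongrightarrow> y"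
    for \<theta> :: "'n cuntz \<Rightarrow> 'a" and X y
  proof -
    have "bounded_linear \<theta>"
      by (rule bounded_linear_intro[where K = 1])
         (simp_all add: unital_star_homD[OF \<theta>] scaleR_scaleC unital_star_hom_norm_le[OF \<theta>])
    then show ?thesis using X by (rule bounded_linear.tendsto)
  qed
  obtain X where X: "(\<lambda>n. cuntz_of (X n)) \<longlonglongrightarrow> x" using cuntz_of_dense by blast
  show "\<phi> x = \<psi> x"
    using cont[OF assms(1) X] cont[OF assms(2) X] LIMSEQ_unique by (simp add: poly)
qed

theorem cuntz_universal:
  fixes t :: "'n::finite \<Rightarrow> 'a::cstar_algebra"
  assumes "cuntz_family t"
  shows "\<exists>!\<phi>. unital_star_hom \<phi> \<and> (\<forall>i. \<phi> (cgen i) = t i)"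
  using cuntz_universal_exists[OF assms] cuntz_hom_eqI by (metis (no_types, lifting))

section \<open>The representations \<open>P\<^sub>N(J)\<close>\<close>

definition cgen_word :: "'n::finite list \<Rightarrow> 'n cuntz" where
  "cgen_word J = prod_list (map cgen J)"

definition P_rep :: "'n::finite list \<Rightarrow> ('n cuntz \<Rightarrow> 'h::chilbert_space \<Rightarrow> 'h) \<Rightarrow> bool" where
  "P_rep J \<pi> \<longleftrightarrow> J \<noteq> [] \<and> representation \<pi> \<and>
     (\<exists>\<Omega>. norm \<Omega> = 1 \<and> cyclic_vector \<pi> \<Omega> \<and> \<pi> (cgen_word J) \<Omega> = \<Omega> \<and>
       (\<forall>l<length J. \<forall>m<length J.
          cinner (\<pi> (cgen_word (drop l J)) \<Omega>) (\<pi> (cgen_word (drop m J)) \<Omega>) = (if l = m then 1 else 0)))"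

section \<open>Endomorphisms permuting the words of length two\<close>

definition cgen3 :: "'n::finite \<Rightarrow> 'n \<Rightarrow> 'n \<Rightarrow> 'n cuntz" where
  "cgen3 i j k = cgen i * cgen j * (cgen k)\<^sup>\<star>"

lemma cgen_star_cgen: "(cgen i)\<^sup>\<star> * cgen j = (if i = j then 1 else 0)"
  using cuntz_family_cgen unfolding cuntz_family_def by blast

lemma cgen_star_cgen_mult: "(cgen i)\<^sup>\<star> * (cgen j * x) = (if i = j then x else 0)"
  by (simp add: cgen_star_cgen flip: mult.assoc)

lemma sum_cgen_cgen_star: "(\<Sum>i\<in>UNIV. cgen i * (cgen i)\<^sup>\<star>) = 1"
  using cuntz_family_cgen unfolding cuntz_family_def by blast

lemma star_sum: "(sum f A)\<^sup>\<star> = (\<Sum>a\<in>A. (f a :: 'a::cstar_algebra)\<^sup>\<star>)"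
  by (induction A rule: infinite_finite_induct) (auto simp: star_add)

lemma cuntz_family_permutative:
  fixes \<sigma> :: "'n::finite \<times> 'n \<Rightarrow> 'n \<times> 'n"
  assumes \<sigma>: "bij \<sigma>"
  shows "cuntz_family (\<lambda>i. \<Sum>k\<in>UNIV. cgen3 (fst (\<sigma> (i, k))) (snd (\<sigma> (i, k))) k)"
    (is "cuntz_family ?t")
proof -
  define w where "w p = cgen (fst p) * cgen (snd p)" for p :: "'n \<times> 'n"
  have w: "(w p)\<^sup>\<star> * (w q * x) = (if p = q then x else 0)" for p q x
    by (auto simp: w_def star_mult mult.assoc cgen_star_cgen_mult prod_eq_iff)
  have t: "?t i = (\<Sum>k\<in>UNIV. w (\<sigma> (i, k)) * (cgen k)\<^sup>\<star>)" for i
    by (simp add: cgen3_def w_def)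
  have eq: "\<sigma> p = \<sigma> q \<longleftrightarrow> p = q" for p q
    using \<sigma> by (auto dest: bij_is_inj injD)
  have "(?t i)\<^sup>\<star> * ?t j = (if i = j then 1 else 0)" for i j
  proof -
    have "(?t i)\<^sup>\<star> * ?t j = (\<Sum>k\<in>UNIV. \<Sum>l\<in>UNIV. cgen k * ((w (\<sigma> (i, k)))\<^sup>\<star> * (w (\<sigma> (j, l)) * (cgen l)\<^sup>\<star>)))"
      unfolding t star_sum sum_product by (simp add: star_mult star_star mult.assoc)
    also have "\<dots> = (\<Sum>k\<in>UNIV. \<Sum>l\<in>UNIV. if k = l then (if i = j then cgen k * (cgen k)\<^sup>\<star> else 0) else 0)"
      by (intro sum.cong refl) (auto simp: w eq)
    also have "\<dots> = (if i = j then 1 else 0)"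
      by (simp add: sum_cgen_cgen_star)
    finally show ?thesis .
  qed
  moreover have "(\<Sum>i\<in>UNIV. ?t i * (?t i)\<^sup>\<star>) = 1"
  proof -
    have "?t i * (?t i)\<^sup>\<star> = (\<Sum>k\<in>UNIV. w (\<sigma> (i, k)) * (w (\<sigma> (i, k)))\<^sup>\<star>)" for i
    proof -
      have "?t i * (?t i)\<^sup>\<star> = (\<Sum>k\<in>UNIV. \<Sum>l\<in>UNIV. w (\<sigma> (i, k)) * ((cgen k)\<^sup>\<star> * (cgen l * (w (\<sigma> (i, l)))\<^sup>\<star>)))"
        unfolding t star_sum sum_product by (simp add: star_mult star_star mult.assoc)
      also have "\<dots> = (\<Sum>k\<in>UNIV. \<Sum>l\<in>UNIV. if k = l then w (\<sigma> (i, k)) * (w (\<sigma> (i, k)))\<^sup>\<star> else 0)"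
        by (intro sum.cong refl) (auto simp: cgen_star_cgen_mult)
      finally show ?thesis by simp
    qed
    then have "(\<Sum>i\<in>UNIV. ?t i * (?t i)\<^sup>\<star>) = (\<Sum>p\<in>UNIV. w (\<sigma> p) * (w (\<sigma> p))\<^sup>\<star>)"
      by (simp add: sum.cartesian_product UNIV_Times_UNIV case_prod_beta)
    also have "\<dots> = (\<Sum>p\<in>UNIV. w p * (w p)\<^sup>\<star>)"
      by (rule sum.reindex_bij_betw) (use \<sigma> in simp)
    also have "\<dots> = (\<Sum>a\<in>UNIV. \<Sum>b\<in>UNIV. cgen a * ((cgen b * (cgen b)\<^sup>\<star>) * (cgen a)\<^sup>\<star>))"
      by (simp add: sum.cartesian_product UNIV_Times_UNIV case_prod_beta w_def star_mult mult.assoc)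
    also have "\<dots> = 1"
      by (simp add: sum_cgen_cgen_star flip: sum_distrib_left sum_distrib_right)
    finally show ?thesis .
  qed
  ultimately show ?thesis unfolding cuntz_family_def by blast
qed

lemma permutative_endomorphism_ex1:
  assumes "bij \<sigma>"
  shows "\<exists>!\<rho>. endomorphism \<rho> \<and>
    (\<forall>i. \<rho> (cgen i) = (\<Sum>k\<in>UNIV. cgen3 (fst (\<sigma> (i, k))) (snd (\<sigma> (i, k))) k))"
  by (rule cuntz_universal[OF cuntz_family_permutative[OF assms]])

lemma rho_well_defined:
  "\<exists>!\<rho> :: 4 cuntz \<Rightarrow> 4 cuntz. endomorphism \<rho> \<and>
     \<rho> (cgen 1) = cgen3 2 3 1 + cgen3 1 4 2 + cgen3 2 1 3 + cgen3 1 2 4 \<and>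
     \<rho> (cgen 2) = cgen3 1 3 1 + cgen3 2 4 2 + cgen3 1 1 3 + cgen3 2 2 4 \<and>
     \<rho> (cgen 3) = cgen3 4 1 1 + cgen3 3 2 2 + cgen3 4 3 3 + cgen3 3 4 4 \<and>
     \<rho> (cgen 4) = cgen3 3 1 1 + cgen3 4 2 2 + cgen3 3 3 3 + cgen3 4 4 4"
proof -
  define \<sigma> :: "4 \<times> 4 \<Rightarrow> 4 \<times> 4" where "\<sigma> = (\<lambda>(i, k).
    if i = 1 then (if k = 1 then (2, 3) else if k = 2 then (1, 4) else if k = 3 then (2, 1) else (1, 2))
    else if i = 2 then (if k = 1 then (1, 3) else if k = 2 then (2, 4) else if k = 3 then (1, 1) else (2, 2))
    else if i = 3 then (if k = 1 then (4, 1) else if k = 2 then (3, 2) else if k = 3 then (4, 3) else (3, 4))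
    else (if k = 1 then (3, 1) else if k = 2 then (4, 2) else if k = 3 then (3, 3) else (4, 4)))"
  have "inj \<sigma>"
    unfolding inj_def split_paired_All forall_4 by (simp add: \<sigma>_def)
  then have "bij \<sigma>" by (simp add: bij_def finite_UNIV_inj_surj)
  from permutative_endomorphism_ex1[OF this] show ?thesis
    unfolding forall_4 sum_4 by (simp add: \<sigma>_def)
qed

lemma rho_bar_well_defined:
  "\<exists>!\<rho> :: 4 cuntz \<Rightarrow> 4 cuntz. endomorphism \<rho> \<and>
     \<rho> (cgen 1) = cgen3 3 2 1 + cgen3 3 1 2 + cgen3 1 4 3 + cgen3 1 3 4 \<and>
     \<rho> (cgen 2) = cgen3 4 1 1 + cgen3 4 2 2 + cgen3 2 3 3 + cgen3 2 4 4 \<and>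
     \<rho> (cgen 3) = cgen3 1 2 1 + cgen3 1 1 2 + cgen3 3 4 3 + cgen3 3 3 4 \<and>
     \<rho> (cgen 4) = cgen3 2 1 1 + cgen3 2 2 2 + cgen3 4 3 3 + cgen3 4 4 4"
proof -
  define \<sigma> :: "4 \<times> 4 \<Rightarrow> 4 \<times> 4" where "\<sigma> = (\<lambda>(i, k).
    if i = 1 then (if k = 1 then (3, 2) else if k = 2 then (3, 1) else if k = 3 then (1, 4) else (1, 3))
    else if i = 2 then (if k = 1 then (4, 1) else if k = 2 then (4, 2) else if k = 3 then (2, 3) else (2, 4))
    else if i = 3 then (if k = 1 then (1, 2) else if k = 2 then (1, 1) else if k = 3 then (3, 4) else (3, 3))
    else (if k = 1 then (2, 1) else if k = 2 then (2, 2) else if k = 3 then (4, 3) else (4, 4)))"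
  have "inj \<sigma>"
    unfolding inj_def split_paired_All forall_4 by (simp add: \<sigma>_def)
  then have "bij \<sigma>" by (simp add: bij_def finite_UNIV_inj_surj)
  from permutative_endomorphism_ex1[OF this] show ?thesis
    unfolding forall_4 sum_4 by (simp add: \<sigma>_def)
qed

end

theory Submission
  imports Defs
begin

text \<open>If \<open>z = s\<^sub>i\<^sup>* z s\<^sub>j\<close> with \<open>i \<noteq> j\<close>, then \<open>z = 0\<close>: approximate \<open>z\<close> by a combination of monomials
  \<open>s\<^sub>A s\<^sub>B\<^sup>*\<close>, each of which is killed by iterating the compression often enough. Likewise a fixed
  point of the compressions by \<open>s\<^sub>i\<close> and by \<open>s\<^sub>j s\<^sub>j\<close> is a scalar.

  Since \<open>\<rho>(s\<^sub>i) s\<^sub>k\<close> is always a product \<open>s\<^sub>a s\<^sub>b\<close>, the blocks \<open>U\<^sub>k\<^sub>l = s\<^sub>k\<^sup>* u s\<^sub>l\<close> of an element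
  \<open>u\<close> intertwining two such endomorphisms satisfy \<open>U\<^sub>k\<^sub>l = s\<^sub>b\<^sup>* U\<^sub>a\<^sub>c s\<^sub>d\<close>. Following
  these relations reduces every block to one of the two fixed point situations, which gives
  irreducibility and inequivalence. The cyclic vector of \<open>P\<^sub>4(1)\<close> itself serves for \<open>P\<^sub>4(24)\<close>, and
  the statements for \<open>\<rho>\<close> carry over to the conjugate endomorphism because the latter is obtained
  from \<open>\<rho>\<close> by conjugation with the automorphism exchanging \<open>s\<^sub>2\<close> and \<open>s\<^sub>3\<close>.\<close>

section \<open>Normal forms of words in the generators and their adjoints\<close>

section \<open>Monomials\<close>

lemma cgen_word_Nil [simp]: "cgen_word [] = 1"
  and cgen_word_Cons: "cgen_word (i # A) = cgen i * cgen_word A"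
  and cgen_word_append: "cgen_word (A @ B) = cgen_word A * cgen_word B"
  by (simp_all add: cgen_word_def)

text \<open>Reduction from the left: a new \<open>s_i\<close> lengthens \<open>A\<close>; a new
  adjoint of \<open>s_i\<close> cancels the first letter of \<open>A\<close>, kills the product
  (coefficient 0), or, if \<open>A\<close> is empty, is absorbed at the end of
  \<open>B\<close>.\<close>

lemma word_eq_monomial:
  fixes w :: "'n::finite free_word"
  shows "\<exists>c A B. cuntz_of (Poly_Mapping.single w 1) = c *\<^sub>C (cgen_word A * (cgen_word B)\<^sup>\<star>)"
proof -
  have "\<exists>c A B. cuntz_of (Poly_Mapping.single (Word xs) 1) = c *\<^sub>C (cgen_word A * (cgen_word B)\<^sup>\<star>)"
    for xs :: "('n \<times> bool) list"
  proof (induction xs)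
    case Nil
    have "cuntz_of (Poly_Mapping.single (Word []) 1) = (1 :: 'n cuntz)"
      by (simp add: cuntz_of_simps flip: zero_free_word_def)
    then show ?case
      by (intro exI[of _ 1] exI[of _ "[]"]) (simp add: scaleC_one)
  next
    case (Cons x xs)
    then obtain c A B where
      IH: "cuntz_of (Poly_Mapping.single (Word xs) 1) = c *\<^sub>C (cgen_word A * (cgen_word B)\<^sup>\<star>)"
      by blast
    obtain i b where x: "x = (i, b)" by (cases x)
    have "Poly_Mapping.single (Word (x # xs)) (1::complex)
        = Poly_Mapping.single (Word [x]) 1 * Poly_Mapping.single (Word xs) 1"
      by (simp add: mult_single plus_free_word_def)
    moreover have "Poly_Mapping.single (Word [x]) 1 = (if b then fstar (fgen i) else fgen i)"
      by (simp add: x fgen_def fstar_single word_star_def)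
    ultimately have eq: "cuntz_of (Poly_Mapping.single (Word (x # xs)) 1)
        = c *\<^sub>C ((if b then (cgen i)\<^sup>\<star> else cgen i) * cgen_word A * (cgen_word B)\<^sup>\<star>)"
      by (simp add: cuntz_of_simps IH cgen_def mult_scaleC_right mult.assoc)
    show ?case
    proof (cases b)
      case False
      then show ?thesis
        by (intro exI[of _ c] exI[of _ "i # A"] exI[of _ B]) (simp add: eq cgen_word_Cons)
    next
      case True
      show ?thesis
      proof (cases A)
        case Nil
        then show ?thesis using True
          by (intro exI[of _ c] exI[of _ "[]"] exI[of _ "B @ [i]"])
             (simp add: eq cgen_word_append cgen_word_Cons star_mult)
      next
        case (Cons j A')
        then show ?thesis using True
          by (intro exI[of _ "if i = j then c else 0"] exI[of _ A'] exI[of _ B])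
             (simp add: eq cgen_word_Cons cgen_star_cgen_mult mult.assoc)
      qed
    qed
  qed
  then show ?thesis by (metis free_word.collapse)
qed

lemma cuntz_of_monomial_induct [case_names add scale monomial]:
  fixes p :: "'n::finite free_alg"
  assumes add: "\<And>x y. P x \<Longrightarrow> P y \<Longrightarrow> P (x + y)"
    and scale: "\<And>c x. P x \<Longrightarrow> P (c *\<^sub>C x)"
    and mono: "\<And>A B. P (cgen_word A * (cgen_word B)\<^sup>\<star>)"
  shows "P (cuntz_of p)"
proof (induction p rule: poly_mapping_add_induct)
  case zero
  show ?case using scale[OF mono[of "[]" "[]"], of 0] by (simp add: cuntz_of_simps)
next
  case (add w c p)
  have "P (cuntz_of (Poly_Mapping.single w 1))"
    using word_eq_monomial[of w] scale mono by metis
  moreover have "cuntz_of (Poly_Mapping.single w c) = c *\<^sub>C cuntz_of (Poly_Mapping.single w 1)"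
    by (simp flip: cuntz_of_simps add: fscale_single)
  ultimately have "P (cuntz_of (Poly_Mapping.single w c))" using scale by metis
  then show ?case unfolding cuntz_of_simps by (intro assms(1) add)
qed

section \<open>Rigidity of elements fixed by contractive compressions\<close>

section \<open>Fixed points of compressions\<close>

text \<open>If \<open>p\<close> is a combination of monomials within \<open>e\<close> of
  \<open>z\<close>, then \<open>a m * p * b m\<close> is still within \<open>e\<close> of
  \<open>a m * z * b m = z\<close>, and for some large \<open>m\<close> it lies in \<open>V\<close>.
  So \<open>z\<close> is in the closure of \<open>V\<close>.\<close>

lemma mem_of_fixed_by_compressions:
  fixes z :: "'n::finite cuntz"
  assumes norm: "\<And>m. norm (a m) \<le> 1" "\<And>m. norm (b m) \<le> 1"
    and fixed: "\<And>m. a m * z * b m = z"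
    and V: "closed V" "\<And>x y. x \<in> V \<Longrightarrow> y \<in> V \<Longrightarrow> x + y \<in> V" "\<And>c x. x \<in> V \<Longrightarrow> c *\<^sub>C x \<in> V"
    and mono: "\<And>A B. \<forall>\<^sub>F m in sequentially. a m * (cgen_word A * (cgen_word B)\<^sup>\<star>) * b m \<in> V"
  shows "z \<in> V"
proof -
  have ev: "\<forall>\<^sub>F m in sequentially. a m * cuntz_of p * b m \<in> V" for p
  proof (induction p rule: cuntz_of_monomial_induct)
    case (add x y)
    then show ?case
      by eventually_elim (simp add: distrib_left distrib_right V)
  next
    case (scale c x)
    then show ?case
      by eventually_elim (simp add: mult_scaleC_left mult_scaleC_right V)
  next
    case (monomial A B)
    show ?case by (rule mono)
  qed
  have "z \<in> closure V"
    unfolding closure_approachable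
  proof (intro allI impI)
    fix e :: real assume "0 < e"
    moreover have "z \<in> closure (range cuntz_of)" by (simp add: closure_range_cuntz_of)
    ultimately obtain p where p: "norm (cuntz_of p - z) < e"
      unfolding closure_approachable by (auto simp: dist_norm)
    obtain m where m: "a m * cuntz_of p * b m \<in> V"
      using ev[of p] by (auto simp: eventually_sequentially)
    have "a m * cuntz_of p * b m - z = a m * (cuntz_of p - z) * b m"
      by (simp add: right_diff_distrib left_diff_distrib fixed)
    also have "norm \<dots> \<le> norm (a m) * norm (cuntz_of p - z) * norm (b m)"
      by (meson mult_right_mono norm_ge_zero norm_mult_ineq order_trans)
    also have "\<dots> \<le> 1 * norm (cuntz_of p - z) * 1"
      by (intro mult_mono norm) auto
    finally have "dist (a m * cuntz_of p * b m) z < e"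
      using p by (simp add: dist_norm)
    then show "\<exists>y\<in>V. dist y z < e" using m by blast
  qed
  then show ?thesis using \<open>closed V\<close> by simp
qed

lemma cgen_power_isometry: "(cgen i ^ m)\<^sup>\<star> * cgen i ^ m = 1"
proof (induction m)
  case (Suc m)
  have "(cgen i ^ Suc m)\<^sup>\<star> * cgen i ^ Suc m = (cgen i ^ m)\<^sup>\<star> * ((cgen i)\<^sup>\<star> * (cgen i * cgen i ^ m))"
    by (simp add: star_mult mult.assoc)
  then show ?case by (simp add: cgen_star_cgen_mult Suc)
qed simp

lemma norm_cgen_power: "norm (cgen i ^ m) = 1"
  by (rule norm_le_1_of_isometry) (rule cgen_power_isometry)

text \<open>Letters cancel one by one; the length bound ensures that the power outlasts the
  word.\<close>

lemma cgen_power_star_word: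
  "length A \<le> m \<Longrightarrow>
    (cgen i ^ m)\<^sup>\<star> * cgen_word A = (if set A \<subseteq> {i} then (cgen i ^ (m - length A))\<^sup>\<star> else 0)"
proof (induction A arbitrary: m)
  case (Cons j A)
  then obtain n where m: "m = Suc n" by (cases m) auto
  have "(cgen i ^ m)\<^sup>\<star> * cgen_word (j # A) = (cgen i ^ n)\<^sup>\<star> * ((cgen i)\<^sup>\<star> * (cgen j * cgen_word A))"
    by (simp add: m cgen_word_Cons star_mult mult.assoc)
  then show ?case
    using Cons.IH[of n] Cons.prems by (cases "i = j") (simp_all add: m cgen_star_cgen_mult)
qed simp

lemma cgen_word_star_power:
  assumes "length B \<le> m"
  shows "(cgen_word B)\<^sup>\<star> * cgen j ^ m = (if set B \<subseteq> {j} then cgen j ^ (m - length B) else 0)"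
proof -
  have "(cgen_word B)\<^sup>\<star> * cgen j ^ m = ((cgen j ^ m)\<^sup>\<star> * cgen_word B)\<^sup>\<star>"
    by (simp add: star_mult star_star)
  also have "\<dots> = (if set B \<subseteq> {j} then cgen j ^ (m - length B) else 0)"
    by (simp add: cgen_power_star_word[OF assms] star_star)
  finally show ?thesis .
qed

lemma compress_monomial:
  assumes "length A \<le> m" "length B \<le> m"
  shows "(cgen i ^ m)\<^sup>\<star> * (cgen_word A * (cgen_word B)\<^sup>\<star>) * cgen j ^ m =
    (if set A \<subseteq> {i} \<and> set B \<subseteq> {j} then (cgen i ^ (m - length A))\<^sup>\<star> * cgen j ^ (m - length B) else 0)"
proof -
  have "(cgen i ^ m)\<^sup>\<star> * (cgen_word A * (cgen_word B)\<^sup>\<star>) * cgen j ^ m =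
      ((cgen i ^ m)\<^sup>\<star> * cgen_word A) * ((cgen_word B)\<^sup>\<star> * cgen j ^ m)"
    by (simp add: mult.assoc)
  then show ?thesis
    by (simp add: cgen_power_star_word[OF assms(1)] cgen_word_star_power[OF assms(2)])
qed

lemma cgen_power_orthogonal:
  assumes "i \<noteq> j" "0 < m" "0 < n"
  shows "(cgen i ^ m)\<^sup>\<star> * cgen j ^ n = 0"
proof -
  obtain m' n' where "m = Suc m'" "n = Suc n'" using assms by (metis gr0_conv_Suc)
  then have "(cgen i ^ m)\<^sup>\<star> * cgen j ^ n = (cgen i ^ m')\<^sup>\<star> * ((cgen i)\<^sup>\<star> * (cgen j * cgen j ^ n'))"
    by (simp add: star_mult mult.assoc)
  then show ?thesis using assms by (simp add: cgen_star_cgen_mult)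
qed

lemma compression_iterate:
  fixes z :: "'n::finite cuntz"
  assumes "(cgen i)\<^sup>\<star> * z * cgen j = z"
  shows "(cgen i ^ m)\<^sup>\<star> * z * cgen j ^ m = z"
proof (induction m)
  case (Suc m)
  have "(cgen i ^ Suc m)\<^sup>\<star> * z * cgen j ^ Suc m
      = (cgen i ^ m)\<^sup>\<star> * ((cgen i)\<^sup>\<star> * z * cgen j) * cgen j ^ m"
    by (simp add: star_mult mult.assoc)
  then show ?case using assms Suc by simp
qed simp

lemma zero_of_offdiagonal_fixed:
  fixes z :: "'n::finite cuntz"
  assumes ij: "i \<noteq> j" and z: "(cgen i)\<^sup>\<star> * z * cgen j = z"
  shows "z = 0"
proof -
  have "z \<in> {0}"
  proof (rule mem_of_fixed_by_compressions[where a = "\<lambda>m. (cgen i ^ m)\<^sup>\<star>" and b = "\<lambda>m. cgen j ^ m"])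
    fix A B :: "'n list"
    show "\<forall>\<^sub>F m in sequentially.
        (cgen i ^ m)\<^sup>\<star> * (cgen_word A * (cgen_word B)\<^sup>\<star>) * cgen j ^ m \<in> {0}"
      \<comment> \<open>The strict bound leaves positive exponents on both sides, so that the
        remaining powers are orthogonal.\<close>
      using eventually_gt_at_top[of "max (length A) (length B)"]
    proof eventually_elim
      case (elim m)
      then show ?case
        using compress_monomial[of A m B i j] cgen_power_orthogonal[OF ij] by simp
    qed
  qed (auto simp: norm_star norm_cgen_power compression_iterate[OF z])
  then show ?thesis by simp
qed

text \<open>The map sending \<open>c\<close> to \<open>c *\<^sub>C 1\<close> is isometric, so its
  image is complete and hence closed.\<close>

lemma closed_scalars: "closed (range (\<lambda>c. c *\<^sub>C (1::'a::cstar_algebra)))"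
proof -
  have d: "dist (c *\<^sub>C (1::'a)) (d *\<^sub>C 1) = dist c d" for c d
  proof -
    have "c *\<^sub>C (1::'a) - d *\<^sub>C 1 = (c - d) *\<^sub>C 1"
      using scaleC_add_left[of "c - d" d "1::'a"] by simp
    then show ?thesis by (simp add: dist_norm norm_scaleC)
  qed
  have "complete (range (\<lambda>c. c *\<^sub>C (1::'a)))"
  proof (rule completeI)
    fix f :: "nat \<Rightarrow> 'a"
    assume r: "\<forall>n. f n \<in> range (\<lambda>c. c *\<^sub>C 1)" and f: "Cauchy f"
    from r have "\<forall>n. \<exists>c. f n = c *\<^sub>C 1" by blast
    then obtain g where g: "\<And>n. f n = g n *\<^sub>C 1" by metis
    then have "Cauchy g" using f by (simp add: Cauchy_def d)
    then obtain l where "g \<longlonglongrightarrow> l" using Cauchy_convergent convergent_def by blast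
    then have "f \<longlonglongrightarrow> l *\<^sub>C 1" unfolding lim_sequentially by (simp add: g d)
    then show "\<exists>l\<in>range (\<lambda>c. c *\<^sub>C 1). f \<longlonglongrightarrow> l" by blast
  qed
  then show ?thesis by (rule complete_imp_closed)
qed

lemma cgen_power_star_power:
  "n \<le> m \<Longrightarrow> (cgen i ^ m)\<^sup>\<star> * cgen i ^ n = (cgen i ^ (m - n))\<^sup>\<star>"
proof (induction n)
  case (Suc n)
  have "(cgen i ^ m)\<^sup>\<star> * cgen i ^ Suc n = ((cgen i ^ m)\<^sup>\<star> * cgen i ^ n) * cgen i"
    by (simp add: power_Suc2 mult.assoc del: power_Suc)
  also have "\<dots> = (cgen i ^ Suc (m - Suc n))\<^sup>\<star> * cgen i"
    using Suc by (simp add: Suc_diff_Suc del: power_Suc)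
  also have "\<dots> = (cgen i ^ (m - Suc n))\<^sup>\<star> * ((cgen i)\<^sup>\<star> * cgen i)"
    by (simp add: star_mult mult.assoc)
  finally show ?case by (simp add: cgen_star_cgen)
qed simp

text \<open>Compressing by \<open>s\<^sub>i\<^sup>m\<close> turns a monomial into a power of \<open>s\<^sub>i\<close> or of its adjoint, and
  compressing further by \<open>s\<^sub>j\<close> kills all of these powers except the zeroth.\<close>

lemma scalar_of_diagonal_fixed:
  fixes z :: "'n::finite cuntz"
  assumes ij: "i \<noteq> j" and zi: "(cgen i)\<^sup>\<star> * z * cgen i = z"
    and zj: "(cgen j * cgen j)\<^sup>\<star> * z * (cgen j * cgen j) = z"
  shows "z \<in> range (\<lambda>c. c *\<^sub>C 1)"
proof -
  \<comment> \<open>The square of \<open>s_j\<close> is taken because the block relations of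
    \<open>\<rho>\<close> lead from \<open>U 4 4\<close> back to itself in two compressions by
    \<open>s_2\<close>.\<close>
  define t where "t = cgen j * cgen j"
  have tt: "t\<^sup>\<star> * t = 1"
    by (simp add: t_def star_mult mult.assoc cgen_star_cgen_mult cgen_star_cgen)
  have tp: "t\<^sup>\<star> * cgen i ^ n * t = (if n = 0 then 1 else 0)" for n
  proof (cases n)
    case (Suc n')
    have "t\<^sup>\<star> * cgen i ^ n * t = (cgen j)\<^sup>\<star> * ((cgen j)\<^sup>\<star> * (cgen i * (cgen i ^ n' * t)))"
      by (simp add: Suc t_def star_mult mult.assoc)
    then show ?thesis using ij Suc by (simp add: cgen_star_cgen_mult)
  qed (simp add: tt)
  have tp': "t\<^sup>\<star> * (cgen i ^ n)\<^sup>\<star> * t = (if n = 0 then 1 else 0)" for n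
    using arg_cong[OF tp[of n], of star] by (simp add: star_mult star_star mult.assoc)
  have diag: "t\<^sup>\<star> * ((cgen i ^ m)\<^sup>\<star> * cgen i ^ n) * t = (if m = n then 1 else 0)" for m n
  proof (cases "n \<le> m")
    case True
    then show ?thesis by (simp add: cgen_power_star_power tp')
  next
    case False
    then have "(cgen i ^ m)\<^sup>\<star> * cgen i ^ n = cgen i ^ (n - m)"
      using arg_cong[OF cgen_power_star_power[of m n i], of star] by (simp add: star_mult star_star)
    then show ?thesis using False by (simp add: tp)
  qed
  have norm: "norm (cgen i ^ m * t) = 1" for m
  proof (rule norm_le_1_of_isometry)
    have "(cgen i ^ m * t)\<^sup>\<star> * (cgen i ^ m * t) = t\<^sup>\<star> * ((cgen i ^ m)\<^sup>\<star> * cgen i ^ m) * t"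
      by (simp add: star_mult mult.assoc)
    then show "(cgen i ^ m * t)\<^sup>\<star> * (cgen i ^ m * t) = 1" by (simp add: diag)
  qed
  let ?V = "range (\<lambda>c. c *\<^sub>C (1::'n cuntz))"
  show ?thesis
  proof (rule mem_of_fixed_by_compressions[where a = "\<lambda>m. (cgen i ^ m * t)\<^sup>\<star>" and b = "\<lambda>m. cgen i ^ m * t"])
    fix m
    show "norm ((cgen i ^ m * t)\<^sup>\<star>) \<le> 1" "norm (cgen i ^ m * t) \<le> 1" by (simp_all add: norm_star norm)
    have "(cgen i ^ m * t)\<^sup>\<star> * z * (cgen i ^ m * t) = t\<^sup>\<star> * ((cgen i ^ m)\<^sup>\<star> * z * cgen i ^ m) * t"
      by (simp add: star_mult mult.assoc)
    then show "(cgen i ^ m * t)\<^sup>\<star> * z * (cgen i ^ m * t) = z"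
      using zj by (simp add: compression_iterate[OF zi] t_def)
  next
    show "x + y \<in> ?V" if "x \<in> ?V" "y \<in> ?V" for x y
      using that by (auto simp flip: scaleC_add_left)
    show "c *\<^sub>C x \<in> ?V" if "x \<in> ?V" for c x
      using that by (auto simp: scaleC_scaleC)
  next
    fix A B :: "'n list"
    show "\<forall>\<^sub>F m in sequentially.
        (cgen i ^ m * t)\<^sup>\<star> * (cgen_word A * (cgen_word B)\<^sup>\<star>) * (cgen i ^ m * t) \<in> ?V"
      using eventually_ge_at_top[of "max (length A) (length B)"]
    proof eventually_elim
      case (elim m)
      have "(cgen i ^ m * t)\<^sup>\<star> * (cgen_word A * (cgen_word B)\<^sup>\<star>) * (cgen i ^ m * t)
          = t\<^sup>\<star> * ((cgen i ^ m)\<^sup>\<star> * (cgen_word A * (cgen_word B)\<^sup>\<star>) * cgen i ^ m) * t"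
        by (simp add: star_mult mult.assoc)
      also have "\<dots> \<in> {0, 1}"
        using elim by (simp add: compress_monomial diag)
      also have "{0, 1} \<subseteq> ?V"
        using rangeI[of "\<lambda>c. c *\<^sub>C (1::'n cuntz)" 0] rangeI[of "\<lambda>c. c *\<^sub>C (1::'n cuntz)" 1]
        by (simp add: scaleC_one)
      finally show ?case .
    qed
  qed (rule closed_scalars)
qed

section \<open>Block relations for intertwiners\<close>

section \<open>Intertwiners\<close>

text \<open>As \<open>\<psi> (cgen i)\<close> is an isometry,
  \<open>u = (\<psi> (cgen i))\<^sup>\<star> * u * \<phi> (cgen i)\<close>. Compressing this by
  \<open>s_k\<close> and \<open>s_l\<close> and rewriting the two products gives the relation; the
  same \<open>i\<close> serves both sides.\<close>

lemma intertwiner_compress: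
  assumes hom: "unital_star_hom \<phi>" "unital_star_hom \<psi>" and u: "\<And>x. u * \<phi> x = \<psi> x * u"
    and k: "\<psi> (cgen i) * cgen k = cgen a * cgen b" and l: "\<phi> (cgen i) * cgen l = cgen c * cgen d"
  shows "(cgen k)\<^sup>\<star> * u * cgen l = (cgen b)\<^sup>\<star> * ((cgen a)\<^sup>\<star> * u * cgen c) * cgen d"
proof -
  have "(cgen b)\<^sup>\<star> * ((cgen a)\<^sup>\<star> * u * cgen c) * cgen d = (cgen a * cgen b)\<^sup>\<star> * u * (cgen c * cgen d)"
    by (simp add: star_mult mult.assoc)
  also have "\<dots> = (cgen k)\<^sup>\<star> * ((\<psi> (cgen i))\<^sup>\<star> * (u * \<phi> (cgen i))) * cgen l"
    by (simp add: star_mult mult.assoc flip: k l)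
  also have "(\<psi> (cgen i))\<^sup>\<star> * (u * \<phi> (cgen i)) = \<psi> ((cgen i)\<^sup>\<star> * cgen i) * u"
    by (simp add: u unital_star_homD[OF hom(2)] mult.assoc)
  also have "\<dots> = u"
    by (simp add: cgen_star_cgen unital_star_homD[OF hom(2)])
  finally show ?thesis by simp
qed

text \<open>Inserting the sum of the range projections on both sides shows that an element is
  determined by its blocks.\<close>

lemma block_decomposition:
  fixes x :: "'n::finite cuntz"
  shows "x = (\<Sum>k\<in>UNIV. \<Sum>l\<in>UNIV. cgen k * ((cgen k)\<^sup>\<star> * x * cgen l) * (cgen l)\<^sup>\<star>)"
proof -
  have "x = (\<Sum>k\<in>UNIV. cgen k * (cgen k)\<^sup>\<star>) * x * (\<Sum>l\<in>UNIV. cgen l * (cgen l)\<^sup>\<star>)"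
    by (simp add: sum_cgen_cgen_star)
  then show ?thesis
    by (subst sum.swap) (simp add: sum_distrib_left sum_distrib_right mult.assoc)
qed

section \<open>Continuity of representations in the algebra variable\<close>

section \<open>Representations\<close>

lemma representationD:
  assumes "representation \<pi>"
  shows "bounded_operator (\<pi> a)" "\<pi> (a + b) v = \<pi> a v + \<pi> b v" "\<pi> (c *\<^sub>C a) v = c *\<^sub>C \<pi> a v"
    "\<pi> (a * b) v = \<pi> a (\<pi> b v)" "\<pi> 1 v = v" "cinner (\<pi> (a\<^sup>\<star>) v) w = cinner v (\<pi> a w)"
  using assms unfolding representation_def by blast+

lemma representation_linear:
  assumes "representation \<pi>"
  shows "\<pi> a (v + w) = \<pi> a v + \<pi> a w" "\<pi> a (c *\<^sub>C v) = c *\<^sub>C \<pi> a v" "\<pi> a 0 = 0"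
  using representationD(1)[OF assms, of a]
  by (auto simp: bounded_operator_def linear_add linear_0 bounded_linear.linear)

lemma representation_zero: "representation \<pi> \<Longrightarrow> \<pi> 0 v = 0"
  using representationD(2)[of \<pi> 0 0 v] by simp

lemma representation_comp:
  assumes "representation \<pi>" "unital_star_hom \<phi>"
  shows "representation (\<pi> \<circ> \<phi>)"
  using assms(1) unfolding representation_def by (simp add: unital_star_homD[OF assms(2)])

lemma norm_scaleC_i: "norm (\<i> *\<^sub>C (v::'h::chilbert_space)) = norm v"
proof -
  have "complex_of_real ((norm (\<i> *\<^sub>C v))\<^sup>2) = \<i> * cinner (\<i> *\<^sub>C v) v"
    by (simp only: cinner_self cinner_scaleC_right)
  also have "cinner (\<i> *\<^sub>C v) v = cnj (\<i> * cinner v v)"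
    by (subst cinner_commute) (simp only: cinner_scaleC_right)
  also have "\<i> * \<dots> = complex_of_real ((norm v)\<^sup>2)"
    by (simp flip: cinner_self)
  finally show ?thesis
    by (metis norm_ge_zero of_real_eq_iff power2_eq_imp_eq)
qed

text \<open>After scaling to norm below 1, \<open>selfadjoint_sqrt\<close> gives a selfadjoint
  \<open>c\<close> with \<open>b * b + c * c = 1\<close>. Then the squared norms of
  \<open>\<pi> b v\<close> and \<open>\<pi> c v\<close> add up to that of \<open>v\<close>.\<close>

lemma representation_selfadjoint_norm_le:
  assumes \<pi>: "representation \<pi>" and a: "a\<^sup>\<star> = a"
  shows "norm (\<pi> a v) \<le> norm a * norm v"
proof -
  note r = representationD[OF \<pi>]
  have contr: "norm (\<pi> b v) \<le> norm v" if b: "b\<^sup>\<star> = b" "norm b < 1" for b v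
  proof -
    obtain c where c: "c\<^sup>\<star> = c" "c * c = 1 - b * b"
      using selfadjoint_sqrt[OF b] by blast
    have sq: "complex_of_real ((norm (\<pi> d v))\<^sup>2) = cinner v (\<pi> (d * d) v)" if "d\<^sup>\<star> = d" for d
      using r(6)[of d v "\<pi> d v"] by (simp only: that cinner_self r(4))
    have "\<pi> (c * c) v + \<pi> (b * b) v = v"
      by (simp add: c(2) r(5) flip: r(2))
    then have "complex_of_real ((norm (\<pi> c v))\<^sup>2 + (norm (\<pi> b v))\<^sup>2) = complex_of_real ((norm v)\<^sup>2)"
      unfolding of_real_add sq[OF c(1)] sq[OF b(1)] cinner_self[of v] cinner_add_right[symmetric]
      by simp
    then have "(norm (\<pi> c v))\<^sup>2 + (norm (\<pi> b v))\<^sup>2 = (norm v)\<^sup>2"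
      by (simp only: of_real_eq_iff)
    then have "(norm (\<pi> b v))\<^sup>2 \<le> (norm v)\<^sup>2"
      using zero_le_power2[of "norm (\<pi> c v)"] by linarith
    then show ?thesis by (rule power2_le_imp_le) simp
  qed
  have bound: "norm (\<pi> a v) \<le> t * norm v" if t: "norm a < t" for t
  proof -
    have "t > 0" using t norm_ge_zero[of a] by linarith
    have "norm (\<pi> (inverse t *\<^sub>R a) v) \<le> norm v"
      using t \<open>t > 0\<close> by (intro contr) (auto simp: star_scaleR a field_simps)
    moreover have "\<pi> (inverse t *\<^sub>R a) v = inverse t *\<^sub>R \<pi> a v"
      by (simp only: scaleR_scaleC hscaleR_scaleC r(3))
    ultimately show ?thesis using \<open>t > 0\<close> by (simp add: field_simps)
  qed
  show ?thesis
  proof (cases "v = 0")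
    case True
    then show ?thesis using representation_linear(3)[OF \<pi>, of a] by simp
  next
    case False
    have "norm (\<pi> a v) / norm v \<le> norm a"
    proof (rule dense_ge)
      fix t assume "norm a < t"
      from bound[OF this] show "norm (\<pi> a v) / norm v \<le> t"
        using False by (simp add: field_simps)
    qed
    then show ?thesis using False by (simp add: field_simps)
  qed
qed

text \<open>The constant 2 counts the real and imaginary parts, each of norm at most
  \<open>norm x\<close>. This suffices for continuity of
  \<open>a \<mapsto> \<pi> a v\<close>.\<close>

lemma representation_norm_le:
  assumes \<pi>: "representation \<pi>"
  shows "norm (\<pi> x v) \<le> 2 * norm x * norm v"
proof -
  define h where "h = (1/2) *\<^sub>R (x + x\<^sup>\<star>)"
  define k where "k = (1/2) *\<^sub>R ((- \<i>) *\<^sub>C (x - x\<^sup>\<star>))"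
  have "k\<^sup>\<star> = (1/2) *\<^sub>R (\<i> *\<^sub>C ((- 1) *\<^sub>C (x - x\<^sup>\<star>)))"
    using scaleR_scaleC[of "- 1" "x - x\<^sup>\<star>"] by (simp add: k_def star_scaleR star_scaleC star_diff star_star)
  then have k: "k\<^sup>\<star> = k" by (simp add: k_def scaleC_scaleC)
  have h: "h\<^sup>\<star> = h" by (simp add: h_def star_scaleR star_add star_star add.commute)
  have "\<i> *\<^sub>C k = (1/2) *\<^sub>R (x - x\<^sup>\<star>)"
    by (simp add: k_def scaleR_scaleC scaleC_scaleC)
  then have x: "x = h + \<i> *\<^sub>C k"
    by (simp add: h_def flip: scaleR_add_right)
  have nh: "norm h \<le> norm x"
    using norm_triangle_ineq[of x "x\<^sup>\<star>"] by (simp add: h_def norm_star)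
  have nk: "norm k \<le> norm x"
    using norm_triangle_ineq4[of x "x\<^sup>\<star>"] by (simp add: k_def norm_star norm_scaleC)
  have "norm (\<pi> x v) \<le> norm (\<pi> h v) + norm (\<pi> k v)"
    using norm_triangle_ineq[of "\<pi> h v" "\<i> *\<^sub>C \<pi> k v"]
    by (simp only: x representationD[OF \<pi>] norm_scaleC_i)
  also have "\<dots> \<le> norm h * norm v + norm k * norm v"
    by (intro add_mono representation_selfadjoint_norm_le \<pi> h k)
  also have "\<dots> \<le> norm x * norm v + norm x * norm v"
    by (intro add_mono mult_right_mono nh nk) auto
  finally show ?thesis by simp
qed

lemma bounded_linear_representation_apply:
  assumes \<pi>: "representation \<pi>"
  shows "bounded_linear (\<lambda>a. \<pi> a v)"
  by (rule bounded_linear_intro[where K = "2 * norm v"])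
     (use representation_norm_le[OF \<pi>, of _ v] in
       \<open>simp_all add: representationD[OF \<pi>] scaleR_scaleC hscaleR_scaleC mult_ac\<close>)

section \<open>Consequences of the action of \<open>\<rho>\<close> on pairs of generators\<close>

section \<open>The endomorphism \<open>\<rho>\<close>\<close>

locale rho_endomorphism =
  fixes \<rho> :: "4 cuntz \<Rightarrow> 4 cuntz"
  assumes endo: "endomorphism \<rho>"
    and rho_1: "\<rho> (cgen 1) = cgen3 2 3 1 + cgen3 1 4 2 + cgen3 2 1 3 + cgen3 1 2 4"
    and rho_2: "\<rho> (cgen 2) = cgen3 1 3 1 + cgen3 2 4 2 + cgen3 1 1 3 + cgen3 2 2 4"
    and rho_3: "\<rho> (cgen 3) = cgen3 4 1 1 + cgen3 3 2 2 + cgen3 4 3 3 + cgen3 3 4 4"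
    and rho_4: "\<rho> (cgen 4) = cgen3 3 1 1 + cgen3 4 2 2 + cgen3 3 3 3 + cgen3 4 4 4"
begin

lemmas hom = unital_star_homD[OF endo]

text \<open>Entry number \<open>4 * (i - 1) + k\<close> is the product for \<open>i\<close> and
  \<open>k\<close>; the proofs below cite entries by this number.\<close>

lemma rho_cgen:
  "\<rho> (cgen 1) * cgen 1 = cgen 2 * cgen 3" "\<rho> (cgen 1) * cgen 2 = cgen 1 * cgen 4"
  "\<rho> (cgen 1) * cgen 3 = cgen 2 * cgen 1" "\<rho> (cgen 1) * cgen 4 = cgen 1 * cgen 2"
  "\<rho> (cgen 2) * cgen 1 = cgen 1 * cgen 3" "\<rho> (cgen 2) * cgen 2 = cgen 2 * cgen 4"
  "\<rho> (cgen 2) * cgen 3 = cgen 1 * cgen 1" "\<rho> (cgen 2) * cgen 4 = cgen 2 * cgen 2"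
  "\<rho> (cgen 3) * cgen 1 = cgen 4 * cgen 1" "\<rho> (cgen 3) * cgen 2 = cgen 3 * cgen 2"
  "\<rho> (cgen 3) * cgen 3 = cgen 4 * cgen 3" "\<rho> (cgen 3) * cgen 4 = cgen 3 * cgen 4"
  "\<rho> (cgen 4) * cgen 1 = cgen 3 * cgen 1" "\<rho> (cgen 4) * cgen 2 = cgen 4 * cgen 2"
  "\<rho> (cgen 4) * cgen 3 = cgen 3 * cgen 3" "\<rho> (cgen 4) * cgen 4 = cgen 4 * cgen 4"
  by (simp_all add: rho_1 rho_2 rho_3 rho_4 cgen3_def distrib_right mult.assoc cgen_star_cgen)

text \<open>The table exhausts all sixteen two-letter products, so \<open>\<rho>\<close> of a
  generator can be split off any word of length at least two.\<close>

lemma rho_cgen_surj: "\<exists>i k. \<rho> (cgen i) * cgen k = cgen a * cgen b"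
proof -
  have "\<forall>a b. \<exists>i k. \<rho> (cgen i) * cgen k = cgen a * cgen b"
    unfolding forall_4 by (intro conjI) (use rho_cgen in blast)+
  then show ?thesis by blast
qed

lemma irreducible: "irreducible_endo \<rho>"
proof -
  have "x \<in> range (\<lambda>c. c *\<^sub>C 1)" if x: "x \<in> commutant (range \<rho>)" for x
  proof -
    define U where "U k l = (cgen k)\<^sup>\<star> * x * cgen l" for k l
    have comm: "x * \<rho> y = \<rho> y * x" for y
      using x by (simp add: commutant_def)
    have U: "U k l = (cgen b)\<^sup>\<star> * U a c * cgen d"
      if "\<rho> (cgen i) * cgen k = cgen a * cgen b" "\<rho> (cgen i) * cgen l = cgen c * cgen d"
      for i k l a b c d
      unfolding U_def by (rule intertwiner_compress[OF endo endo comm that])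
    have U34: "U 3 4 = 0"
      using U[OF rho_cgen(15,16)] by (intro zero_of_offdiagonal_fixed[of 3 4]) auto
    have U43: "U 4 3 = 0"
      using U[OF rho_cgen(16,15)] by (intro zero_of_offdiagonal_fixed[of 4 3]) auto
    \<comment> \<open>Compression by \<open>s_2\<close> exchanges \<open>U 2 2\<close> and
      \<open>U 4 4\<close>, so doing it twice fixes \<open>U 4 4\<close>.\<close>
    have "(cgen 2 * cgen 2)\<^sup>\<star> * U 4 4 * (cgen 2 * cgen 2)
        = (cgen 2)\<^sup>\<star> * ((cgen 2)\<^sup>\<star> * U 4 4 * cgen 2) * cgen 2"
      by (simp add: star_mult mult.assoc)
    also have "\<dots> = U 4 4"
      by (simp flip: U[OF rho_cgen(14,14)] U[OF rho_cgen(8,8)])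
    finally have "U 4 4 \<in> range (\<lambda>c. c *\<^sub>C 1)"
      using U[OF rho_cgen(16,16)] by (intro scalar_of_diagonal_fixed[of 4 2]) auto
    then obtain c where U44: "U 4 4 = c *\<^sub>C 1" by blast
    have U22: "U 2 2 = c *\<^sub>C 1"
      using U[OF rho_cgen(14,14)] by (simp add: U44 mult_scaleC_left mult_scaleC_right cgen_star_cgen)
    have U11: "U 1 1 = c *\<^sub>C 1"
      using U[OF rho_cgen(1,1)] by (simp add: U22 mult_scaleC_left mult_scaleC_right cgen_star_cgen)
    have U33: "U 3 3 = c *\<^sub>C 1"
      using U[OF rho_cgen(3,3)] by (simp add: U22 mult_scaleC_left mult_scaleC_right cgen_star_cgen)
    \<comment> \<open>In each pair the two products share their first letter, so the block is a
      scalar block compressed by two distinct generators.\<close>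
    have par: "U 1 3 = 0" "U 3 1 = 0" "U 2 4 = 0" "U 4 2 = 0"
      using U[OF rho_cgen(1,3)] U[OF rho_cgen(3,1)] U[OF rho_cgen(2,4)] U[OF rho_cgen(4,2)]
      by (simp_all add: U11 U22 mult_scaleC_left mult_scaleC_right cgen_star_cgen)
    \<comment> \<open>The products for \<open>s_4\<close> start with 3 for odd \<open>k\<close> and
      with 4 for even \<open>k\<close>, so blocks of mixed parity reduce to \<open>U 3 4\<close> or
      \<open>U 4 3\<close>.\<close>
    have off: "U 1 2 = 0" "U 1 4 = 0" "U 3 2 = 0" "U 2 1 = 0" "U 2 3 = 0" "U 4 1 = 0"
      using U[OF rho_cgen(13,14)] U[OF rho_cgen(13,16)] U[OF rho_cgen(15,14)]
        U[OF rho_cgen(14,13)] U[OF rho_cgen(14,15)] U[OF rho_cgen(16,13)]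
      by (simp_all add: U34 U43)
    have "\<forall>k l. U k l = (if k = l then c *\<^sub>C 1 else 0)"
      unfolding forall_4 by (simp add: U11 U22 U33 U44 U34 U43 par off)
    then have diag: "U k l = (if k = l then c *\<^sub>C 1 else 0)" for k l by blast
    have "x = (\<Sum>k\<in>UNIV. \<Sum>l\<in>UNIV. cgen k * U k l * (cgen l)\<^sup>\<star>)"
      unfolding U_def by (rule block_decomposition)
    also have "\<dots> = (\<Sum>k\<in>UNIV. \<Sum>l\<in>UNIV. if k = l then c *\<^sub>C (cgen k * (cgen k)\<^sup>\<star>) else 0)"
      by (intro sum.cong refl) (simp add: diag mult_scaleC_left mult_scaleC_right)
    also have "\<dots> = c *\<^sub>C (\<Sum>k\<in>UNIV. cgen k * (cgen k)\<^sup>\<star>)"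
      by (simp add: sum_4 scaleC_add_right)
    finally show ?thesis by (simp add: sum_cgen_cgen_star)
  qed
  moreover have "c *\<^sub>C 1 \<in> commutant (range \<rho>)" for c
    by (simp add: commutant_def mult_scaleC_left mult_scaleC_right)
  ultimately show ?thesis unfolding irreducible_endo_def by blast
qed

text \<open>The element \<open>y\<close> below satisfies \<open>y = \<rho>(s\<^sub>2)\<^sup>* y \<rho>(s\<^sub>4)\<close>, so a preimage of it under an
  injective \<open>\<rho>\<close> would be a nonzero fixed point of an off-diagonal compression.\<close>

lemma not_automorphism: "\<not> automorphism \<rho>"
proof
  assume "automorphism \<rho>"
  then have bij: "bij \<rho>" by (simp add: automorphism_def)
  define y :: "4 cuntz" where "y = cgen 2 * (cgen 4)\<^sup>\<star> + cgen 4 * (cgen 2)\<^sup>\<star>"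
  obtain x where x: "\<rho> x = y" using bij by (metis bij_pointE)
  have "\<rho> ((cgen 2)\<^sup>\<star> * x * cgen 4) = (\<rho> (cgen 2))\<^sup>\<star> * y * \<rho> (cgen 4)"
    by (simp add: hom x)
  \<comment> \<open>The summand \<open>s_2 s_4^*\<close> alone is mapped to all of \<open>y\<close>,
    and \<open>s_4 s_2^*\<close> is mapped to 0.\<close>
  also have "\<dots> = y"
    by (simp add: rho_2 rho_4 y_def cgen3_def star_add star_mult star_star distrib_left distrib_right
        mult.assoc cgen_star_cgen cgen_star_cgen_mult add.commute)
  finally have "(cgen 2)\<^sup>\<star> * x * cgen 4 = x"
    using bij x by (metis bij_is_inj injD)
  then have "x = 0" by (intro zero_of_offdiagonal_fixed[of 2 4]) auto
  then have "y = 0" using hom(2)[of 0 0] x by simp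
  moreover have "(cgen 2)\<^sup>\<star> * y * cgen 4 = 1"
    by (simp add: y_def distrib_left distrib_right mult.assoc cgen_star_cgen cgen_star_cgen_mult)
  ultimately show False by simp
qed

text \<open>All blocks of a unitary intertwiner vanish, which is absurd. The relations from
  \<open>s_4\<close> only make \<open>U 4 4\<close> a fixed point of a diagonal compression;
  \<open>s_1\<close> links it to \<open>U 1 1\<close>, which vanishes with
  \<open>U 2 3\<close>.\<close>

lemma not_equivalent_rho_bar:
  assumes endo': "endomorphism \<rho>'"
    and rho'_1: "\<rho>' (cgen 1) = cgen3 3 2 1 + cgen3 3 1 2 + cgen3 1 4 3 + cgen3 1 3 4"
    and rho'_4: "\<rho>' (cgen 4) = cgen3 2 1 1 + cgen3 2 2 2 + cgen3 4 3 3 + cgen3 4 4 4"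
  shows "\<not> equivalent_endo \<rho> \<rho>'"
proof
  assume "equivalent_endo \<rho> \<rho>'"
  then obtain u where u: "u\<^sup>\<star> * u = 1" and Ad: "Ad u \<circ> \<rho> = \<rho>'"
    unfolding equivalent_endo_def unitary_def by blast
  have comm: "u * \<rho> x = \<rho>' x * u" for x
  proof -
    have "\<rho>' x * u = u * \<rho> x * (u\<^sup>\<star> * u)"
      by (simp add: Ad_def mult.assoc flip: Ad)
    then show ?thesis by (simp add: u)
  qed
  have cgen': "\<rho>' (cgen 4) * cgen 1 = cgen 2 * cgen 1" "\<rho>' (cgen 4) * cgen 2 = cgen 2 * cgen 2"
    "\<rho>' (cgen 4) * cgen 3 = cgen 4 * cgen 3" "\<rho>' (cgen 4) * cgen 4 = cgen 4 * cgen 4"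
    "\<rho>' (cgen 1) * cgen 4 = cgen 1 * cgen 3"
    by (simp_all add: rho'_1 rho'_4 cgen3_def distrib_right mult.assoc cgen_star_cgen)
  define U where "U k l = (cgen k)\<^sup>\<star> * u * cgen l" for k l
  have U: "U k l = (cgen b)\<^sup>\<star> * U a c * cgen d"
    if "\<rho>' (cgen i) * cgen k = cgen a * cgen b" "\<rho> (cgen i) * cgen l = cgen c * cgen d"
    for i k l a b c d
    unfolding U_def by (rule intertwiner_compress[OF endo endo' comm that])
  have U43: "U 4 3 = 0"
    using U[OF cgen'(4) rho_cgen(15)] by (intro zero_of_offdiagonal_fixed[of 4 3]) auto
  have U23: "U 2 3 = 0"
    using U[OF cgen'(2) rho_cgen(15)] by (intro zero_of_offdiagonal_fixed[of 2 3]) auto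
  have U24: "U 2 4 = 0"
    using U[OF cgen'(2) rho_cgen(16)] by (intro zero_of_offdiagonal_fixed[of 2 4]) auto
  have "U 1 1 = 0" using U[OF cgen'(1) rho_cgen(13)] by (simp add: U23)
  then have U44: "U 4 4 = 0" using U[OF cgen'(5) rho_cgen(4)] by simp
  have "U k l = 0" for k l
  proof -
    \<comment> \<open>By the possible first letters, every block is a compression of one of
      \<open>U 2 3\<close>, \<open>U 2 4\<close>, \<open>U 4 3\<close>, \<open>U 4 4\<close>, all
      known to be zero.\<close>
    have "\<exists>a b. a \<in> {2, 4} \<and> \<rho>' (cgen 4) * cgen k = cgen a * cgen b"
    proof -
      have "\<forall>k. \<exists>a b. a \<in> {2, 4} \<and> \<rho>' (cgen 4) * cgen k = cgen a * cgen b"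
        unfolding forall_4 using cgen' by blast
      then show ?thesis by blast
    qed
    moreover have "\<exists>c d. c \<in> {3, 4} \<and> \<rho> (cgen 4) * cgen l = cgen c * cgen d"
    proof -
      have "\<forall>l. \<exists>c d. c \<in> {3, 4} \<and> \<rho> (cgen 4) * cgen l = cgen c * cgen d"
        unfolding forall_4 using rho_cgen(13-16) by blast
      then show ?thesis by blast
    qed
    ultimately obtain a b c d where ac: "a \<in> {2, 4}" "c \<in> {3, 4}" and
      eq: "\<rho>' (cgen 4) * cgen k = cgen a * cgen b" "\<rho> (cgen 4) * cgen l = cgen c * cgen d"
      by blast
    have "U a c = 0" using ac U23 U24 U43 U44 by auto
    then show ?thesis using U[OF eq] by simp
  qed
  then have "u = 0" using block_decomposition[of u] by (simp add: U_def)
  then show False using u by simp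
qed

text \<open>The orbit \<open>M\<close> of \<open>\<Omega>\<close> under the range of
  \<open>\<rho>\<close> contains every monomial applied to \<open>\<Omega>\<close>, hence is dense.
  The other vector of the cycle is \<open>s_3 \<Omega> = \<rho>(s_4) \<Omega>\<close>.\<close>

lemma P_rep_comp:
  fixes \<pi> :: "4 cuntz \<Rightarrow> 'h::chilbert_space \<Rightarrow> 'h"
  assumes "P_rep [1] \<pi>"
  shows "P_rep [2, 4] (\<pi> \<circ> \<rho>)"
proof -
  from assms obtain \<Omega> where \<pi>: "representation \<pi>" and \<Omega>: "norm \<Omega> = 1" "cyclic_vector \<pi> \<Omega>"
    and s1: "\<pi> (cgen 1) \<Omega> = \<Omega>"
    unfolding P_rep_def by (auto simp: cgen_word_def)
  note r = representationD[OF \<pi>] and l = representation_linear[OF \<pi>]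
  define M where "M = range (\<lambda>a. \<pi> (\<rho> a) \<Omega>)"
  have M_rho: "\<pi> (\<rho> x) v \<in> M" if "v \<in> M" for x v
    using that unfolding M_def by (auto simp flip: r(4) hom(3))
  have M_\<Omega>: "\<Omega> \<in> M"
    unfolding M_def by (rule range_eqI[of _ _ 1]) (simp add: hom r)
  \<comment> \<open>As \<open>s_1\<close> fixes \<open>\<Omega>\<close>, it supplies a second
    letter, so that \<open>rho_cgen\<close> applies to single generators.\<close>
  have s1': "\<pi> (cgen k) \<Omega> = \<pi> (cgen k * cgen 1) \<Omega>" for k
    by (simp add: r s1)
  have s3: "\<pi> (cgen 3) \<Omega> = \<pi> (\<rho> (cgen 4)) \<Omega>"
    unfolding s1'[of 3] rho_cgen(13)[symmetric] by (simp add: r s1)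
  have M_cgen: "\<pi> (cgen k) \<Omega> \<in> M" for k
  proof -
    have 3: "\<pi> (cgen 3) \<Omega> \<in> M" unfolding s3 by (intro M_rho M_\<Omega>)
    have 2: "\<pi> (cgen 2) \<Omega> \<in> M"
      unfolding s1'[of 2] rho_cgen(3)[symmetric] r(4) by (intro M_rho 3)
    have 4: "\<pi> (cgen 4) \<Omega> \<in> M"
      unfolding s1'[of 4] rho_cgen(9)[symmetric] r(4) s1 by (intro M_rho M_\<Omega>)
    have "\<forall>k. \<pi> (cgen k) \<Omega> \<in> M"
      unfolding forall_4 using 2 3 4 by (simp add: s1 M_\<Omega>)
    then show ?thesis by blast
  qed
  have M_word: "\<pi> (cgen_word A) \<Omega> \<in> M" for A
  proof (induction A rule: length_induct)
    case (1 A)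
    consider "A = []" | k where "A = [k]" | a b B where "A = a # b # B"
      by (metis list.exhaust)
    then show ?case
    proof cases
      \<comment> \<open>The first two letters become \<open>\<rho> (cgen i) * cgen k\<close>,
        leaving a word that is one letter shorter.\<close>
      case (3 a b B)
      obtain i k where ik: "\<rho> (cgen i) * cgen k = cgen a * cgen b" using rho_cgen_surj by blast
      have "cgen_word A = (cgen a * cgen b) * cgen_word B"
        by (simp add: 3 cgen_word_Cons mult.assoc)
      also have "\<dots> = \<rho> (cgen i) * cgen_word (k # B)"
        by (simp add: ik[symmetric] cgen_word_Cons mult.assoc)
      finally have "\<pi> (cgen_word A) \<Omega> = \<pi> (\<rho> (cgen i)) (\<pi> (cgen_word (k # B)) \<Omega>)"
        by (simp add: r)
      then show ?thesis using 1 3 M_rho by simp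
    qed (simp_all add: r cgen_word_Cons M_\<Omega> M_cgen)
  qed
  \<comment> \<open>Writing \<open>\<Omega>\<close> as \<open>s_1 \<Omega>\<close> shows that the
    adjoint of \<open>s_i\<close> sends it to \<open>\<Omega>\<close> or 0.\<close>
  have word_star: "\<pi> ((cgen_word B)\<^sup>\<star>) \<Omega> \<in> {0, \<Omega>}" for B
  proof (induction B)
    case (Cons i B)
    have "\<pi> ((cgen_word (i # B))\<^sup>\<star>) \<Omega> = \<pi> ((cgen_word B)\<^sup>\<star>) (\<pi> ((cgen i)\<^sup>\<star>) (\<pi> (cgen 1) \<Omega>))"
      by (simp add: cgen_word_Cons star_mult r s1)
    also have "\<pi> ((cgen i)\<^sup>\<star>) (\<pi> (cgen 1) \<Omega>) = (if i = 1 then \<Omega> else 0)"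
      by (simp flip: r(4) add: cgen_star_cgen r representation_zero[OF \<pi>])
    finally show ?case using Cons l(3) by auto
  qed (simp add: r)
  have M_0: "0 \<in> M"
    unfolding M_def using hom(2)[of 0 0] by (intro range_eqI[of _ _ 0]) (simp add: representation_zero[OF \<pi>])
  have M_of: "\<pi> (cuntz_of p) \<Omega> \<in> M" for p
  proof (induction p rule: cuntz_of_monomial_induct)
    case (add x y)
    then obtain a b where "\<pi> x \<Omega> = \<pi> (\<rho> a) \<Omega>" "\<pi> y \<Omega> = \<pi> (\<rho> b) \<Omega>"
      unfolding M_def by blast
    then show ?case unfolding M_def by (intro range_eqI[of _ _ "a + b"]) (simp add: r hom)
  next
    case (scale c x)
    then obtain a where "\<pi> x \<Omega> = \<pi> (\<rho> a) \<Omega>"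
      unfolding M_def by blast
    then show ?case unfolding M_def by (intro range_eqI[of _ _ "c *\<^sub>C a"]) (simp add: r hom)
  next
    case (monomial A B)
    then show ?case using word_star[of B] M_word[of A] M_0 l(3) by (auto simp: r)
  qed
  have "\<pi> a \<Omega> \<in> closure M" for a
  proof -
    obtain X where "(\<lambda>n. cuntz_of (X n)) \<longlonglongrightarrow> a" using cuntz_of_dense by blast
    then have "(\<lambda>n. \<pi> (cuntz_of (X n)) \<Omega>) \<longlonglongrightarrow> \<pi> a \<Omega>"
      by (rule bounded_linear.tendsto[OF bounded_linear_representation_apply[OF \<pi>]])
    then show ?thesis
      unfolding closure_sequential using M_of by (intro exI[of _ "\<lambda>n. \<pi> (cuntz_of (X n)) \<Omega>"]) simp
  qed
  then have "closure (range (\<lambda>a. \<pi> a \<Omega>)) \<subseteq> closure M"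
    by (intro closure_minimal) auto
  then have cyclic: "cyclic_vector (\<pi> \<circ> \<rho>) \<Omega>"
    using \<Omega>(2) by (auto simp: cyclic_vector_def M_def)
  have adj: "cinner (\<pi> a v) w = cinner v (\<pi> (a\<^sup>\<star>) w)" for a v w
    using r(6)[of "a\<^sup>\<star>" v w] by (simp add: star_star)
  have c0: "cinner v 0 = 0" for v :: 'h
    using cinner_add_right[of v 0 0] by simp
  have one: "cinner \<Omega> \<Omega> = 1"
    using cinner_self[of \<Omega>] \<Omega>(1) by simp
  have "\<pi> ((cgen 3)\<^sup>\<star>) \<Omega> = \<pi> ((cgen 3)\<^sup>\<star> * cgen 1) \<Omega>" by (simp add: r s1)
  then have orth: "cinner (\<pi> (cgen 3) \<Omega>) \<Omega> = 0"
    by (simp add: adj cgen_star_cgen representation_zero[OF \<pi>] c0)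
  then have orth': "cinner \<Omega> (\<pi> (cgen 3) \<Omega>) = 0"
    by (subst cinner_commute) simp
  have norm3: "cinner (\<pi> (cgen 3) \<Omega>) (\<pi> (cgen 3) \<Omega>) = 1"
    by (simp add: adj one cgen_star_cgen r(5) flip: r(4))
  have w4: "\<pi> (\<rho> (cgen_word [4])) \<Omega> = \<pi> (cgen 3) \<Omega>"
    by (simp add: s3 cgen_word_Cons)
  have "\<pi> (\<rho> (cgen_word [2, 4])) \<Omega> = \<pi> (\<rho> (cgen 2)) (\<pi> (cgen 3) \<Omega>)"
    by (simp add: s3 cgen_word_Cons hom r)
  \<comment> \<open>The cycle closes because
    \<open>\<rho> (cgen 2) * cgen 3 = cgen 1 * cgen 1\<close>.\<close>
  also have "\<dots> = \<Omega>"
    by (simp flip: r(4) add: rho_cgen) (simp add: r s1)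
  finally have w24: "\<pi> (\<rho> (cgen_word [2, 4])) \<Omega> = \<Omega>" .
  show ?thesis
    unfolding P_rep_def
    using representation_comp[OF \<pi> endo] \<Omega>(1) cyclic w24 w4 one orth orth' norm3
    by (auto intro!: exI[of _ \<Omega>] simp: less_Suc_eq numeral_2_eq_2)
qed

end

section \<open>The flip automorphism and transport along it\<close>

section \<open>The flip of \<open>s\<^sub>2\<close> and \<open>s\<^sub>3\<close>\<close>

lemma unital_star_hom_comp:
  "unital_star_hom \<phi> \<Longrightarrow> unital_star_hom \<psi> \<Longrightarrow> unital_star_hom (\<phi> \<circ> \<psi>)"
  by (simp add: unital_star_hom_def)

lemma unital_star_hom_id: "unital_star_hom (\<lambda>x. x)"
  by (simp add: unital_star_hom_def)

text \<open>The permuted generators again form a Cuntz family; the resulting endomorphism squares to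
  the identity because both agree on generators.\<close>

lemma ex_flip:
  obtains \<theta> :: "4 cuntz \<Rightarrow> 4 cuntz" where "endomorphism \<theta>" "\<And>x. \<theta> (\<theta> x) = x"
    "\<theta> (cgen 1) = cgen 1" "\<theta> (cgen 2) = cgen 3" "\<theta> (cgen 3) = cgen 2" "\<theta> (cgen 4) = cgen 4"
proof -
  define f :: "4 \<Rightarrow> 4" where "f i = (if i = 2 then 3 else if i = 3 then 2 else i)" for i
  have f: "f (f i) = i" for i by (simp add: f_def)
  have "bij f" using f by (rule involuntory_imp_bij)
  then have "(\<Sum>i\<in>UNIV. cgen (f i) * (cgen (f i))\<^sup>\<star>) = (1 :: 4 cuntz)"
    using sum.reindex_bij_betw[of f UNIV UNIV "\<lambda>i. cgen i * (cgen i)\<^sup>\<star>"] by (simp add: sum_cgen_cgen_star)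
  then have "cuntz_family (\<lambda>i. cgen (f i))"
    using f by (auto simp: cuntz_family_def cgen_star_cgen) metis
  then obtain \<theta> :: "4 cuntz \<Rightarrow> 4 cuntz" where \<theta>: "endomorphism \<theta>" "\<And>i. \<theta> (cgen i) = cgen (f i)"
    using cuntz_universal_exists by metis
  have "\<theta> \<circ> \<theta> = (\<lambda>x. x)"
    by (rule cuntz_hom_eqI[OF unital_star_hom_comp[OF \<theta>(1) \<theta>(1)] unital_star_hom_id])
       (simp add: \<theta>(2) f)
  then have "\<theta> (\<theta> x) = x" for x by (metis comp_apply)
  then show ?thesis using that[of \<theta>] \<theta> by (simp add: f_def)
qed

text \<open>Surjectivity of \<open>\<theta>\<close> keeps every orbit, hence cyclicity; words are
  merely relabelled letter by letter.\<close>

lemma P_rep_flip: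
  assumes \<theta>: "endomorphism \<theta>" "\<And>x. \<theta> (\<theta> x) = x" and gen: "\<And>i. \<theta> (cgen i) = cgen (f i)"
    and P: "P_rep J \<pi>" and J: "J = map f K"
  shows "P_rep K (\<pi> \<circ> \<theta>)"
proof -
  have word: "\<theta> (cgen_word A) = cgen_word (map f A)" for A
    by (induction A) (simp_all add: cgen_word_Cons unital_star_homD[OF \<theta>(1)] gen)
  have "surj \<theta>" by (metis \<theta>(2) surjI)
  then have "range (\<lambda>a. \<pi> (\<theta> a) \<Omega>) = range (\<lambda>a. \<pi> a \<Omega>)" for \<Omega>
    using image_image[of "\<lambda>a. \<pi> a \<Omega>" \<theta> UNIV] by simp
  then show ?thesis
    using P representation_comp[OF _ \<theta>(1), of \<pi>]
    unfolding P_rep_def cyclic_vector_def J by (auto simp: word drop_map)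
qed

text \<open>The involution \<open>\<theta>\<close> carries the commutant of the conjugated range
  into that of the range of \<open>\<rho>\<close> and fixes scalars.\<close>

lemma irreducible_endo_conjugate:
  assumes \<theta>: "endomorphism \<theta>" "\<And>x. \<theta> (\<theta> x) = x" and irr: "irreducible_endo \<rho>"
  shows "irreducible_endo (\<theta> \<circ> \<rho> \<circ> \<theta>)"
proof -
  note h = unital_star_homD[OF \<theta>(1)]
  have "x \<in> range (\<lambda>c. c *\<^sub>C 1)" if x: "x \<in> commutant (range (\<theta> \<circ> \<rho> \<circ> \<theta>))" for x
  proof -
    have "\<theta> x * \<rho> y = \<rho> y * \<theta> x" for y
    proof -
      have "x * \<theta> (\<rho> (\<theta> (\<theta> y))) = \<theta> (\<rho> (\<theta> (\<theta> y))) * x"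
        using x by (simp add: commutant_def)
      from arg_cong[OF this, of \<theta>] show ?thesis by (simp add: h \<theta>(2))
    qed
    then have "\<theta> x \<in> range (\<lambda>c. c *\<^sub>C 1)"
      using irr by (auto simp: irreducible_endo_def commutant_def)
    then obtain c where "\<theta> x = c *\<^sub>C 1" by blast
    from arg_cong[OF this, of \<theta>] show ?thesis by (simp add: h \<theta>(2))
  qed
  moreover have "c *\<^sub>C 1 \<in> commutant (range (\<theta> \<circ> \<rho> \<circ> \<theta>))" for c
    by (simp add: commutant_def mult_scaleC_left mult_scaleC_right)
  ultimately show ?thesis unfolding irreducible_endo_def by blast
qed

section \<open>Transfer from \<open>rho\<close> to \<open>rho_bar\<close>\<close>

theorem proposition4p1:
  fixes rho rho_bar :: "4 cuntz \<Rightarrow> 4 cuntz"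
  assumes "endomorphism rho"
    and "rho (cgen 1) = cgen3 2 3 1 + cgen3 1 4 2 + cgen3 2 1 3 + cgen3 1 2 4"
    and "rho (cgen 2) = cgen3 1 3 1 + cgen3 2 4 2 + cgen3 1 1 3 + cgen3 2 2 4"
    and "rho (cgen 3) = cgen3 4 1 1 + cgen3 3 2 2 + cgen3 4 3 3 + cgen3 3 4 4"
    and "rho (cgen 4) = cgen3 3 1 1 + cgen3 4 2 2 + cgen3 3 3 3 + cgen3 4 4 4"
    and "endomorphism rho_bar"
    and "rho_bar (cgen 1) = cgen3 3 2 1 + cgen3 3 1 2 + cgen3 1 4 3 + cgen3 1 3 4"
    and "rho_bar (cgen 2) = cgen3 4 1 1 + cgen3 4 2 2 + cgen3 2 3 3 + cgen3 2 4 4"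
    and "rho_bar (cgen 3) = cgen3 1 2 1 + cgen3 1 1 2 + cgen3 3 4 3 + cgen3 3 3 4"
    and "rho_bar (cgen 4) = cgen3 2 1 1 + cgen3 2 2 2 + cgen3 4 3 3 + cgen3 4 4 4"
  shows "(\<forall>\<pi> :: 4 cuntz \<Rightarrow> 'h::chilbert_space \<Rightarrow> 'h. P_rep [1] \<pi> \<longrightarrow>
            P_rep [2, 4] (\<pi> \<circ> rho) \<and> P_rep [3, 4] (\<pi> \<circ> rho_bar)) \<and>
         (irreducible_endo rho \<and> irreducible_endo rho_bar \<and>
            \<not> automorphism rho \<and> \<not> automorphism rho_bar) \<and>
         \<not> equivalent_endo rho rho_bar"
proof -
  interpret rho_endomorphism rho
    using assms(1-5) by unfold_locales
  obtain \<theta> :: "4 cuntz \<Rightarrow> 4 cuntz" where \<theta>: "endomorphism \<theta>" "\<And>x. \<theta> (\<theta> x) = x"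
    and gen: "\<theta> (cgen 1) = cgen 1" "\<theta> (cgen 2) = cgen 3" "\<theta> (cgen 3) = cgen 2" "\<theta> (cgen 4) = cgen 4"
    using ex_flip by blast
  note h = unital_star_homD[OF \<theta>(1)]
  define f :: "4 \<Rightarrow> 4" where "f i = (if i = 2 then 3 else if i = 3 then 2 else i)" for i
  have "\<forall>i. \<theta> (cgen i) = cgen (f i)"
    unfolding forall_4 by (simp add: f_def gen)
  then have f: "\<theta> (cgen i) = cgen (f i)" for i by blast
  have "\<forall>i. rho_bar (cgen i) = (\<theta> \<circ> rho \<circ> \<theta>) (cgen i)"
    unfolding forall_4 by (simp add: gen assms cgen3_def h add_ac)
  then have bar: "rho_bar = \<theta> \<circ> rho \<circ> \<theta>"
    by (intro cuntz_hom_eqI assms(6) unital_star_hom_comp \<theta>(1) assms(1)) blast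
  have "P_rep [3, 4] (\<pi> \<circ> rho_bar)" if "P_rep [1] \<pi>" for \<pi> :: "4 cuntz \<Rightarrow> 'h \<Rightarrow> 'h"
  proof -
    \<comment> \<open>The flip fixes the letter 1 and turns 24 into 34, so it is applied once on
      each side of \<open>rho\<close>.\<close>
    have "P_rep [1] (\<pi> \<circ> \<theta>)"
      by (rule P_rep_flip[OF \<theta> f that]) (simp add: f_def)
    from P_rep_comp[OF this] have "P_rep [3, 4] (\<pi> \<circ> \<theta> \<circ> rho \<circ> \<theta>)"
      by (rule P_rep_flip[OF \<theta> f]) (simp add: f_def)
    then show ?thesis by (simp add: bar comp_assoc)
  qed
  moreover have "\<not> automorphism rho_bar"
  proof
    assume "automorphism rho_bar"
    moreover have "bij \<theta>" using \<theta>(2) by (rule involuntory_imp_bij)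
    moreover have "rho = \<theta> \<circ> rho_bar \<circ> \<theta>" by (simp add: bar fun_eq_iff \<theta>(2))
    ultimately have "automorphism rho"
      using assms(1) by (metis automorphism_def bij_comp)
    then show False using not_automorphism by simp
  qed
  moreover have "irreducible_endo rho_bar"
    unfolding bar by (rule irreducible_endo_conjugate[OF \<theta> irreducible])
  ultimately show ?thesis
    using P_rep_comp irreducible not_automorphism not_equivalent_rho_bar[OF assms(6,7,10)] by blast
qed

end
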